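(* There is a deterministic distributed algorithm in the CONGEST model that computes a maximal independent set of the input graph $G$ within $O(D\log^2 n)$ rounds, where $n$ is the number of nodes and $D$ is the diameter of $G$.
   Context: The input is a connected undirected graph $G=(V,E)$ with $n=|V|$ nodes, each node knowing its own unique $O(\log n)$-bit identifier and its incident edges. In the CONGEST model the communication network is $G$ itself: computation proceeds in synchronous rounds, in each round each node may send a (possibly different) message of $O(\log n)$ bits to each of its neighbors in $G$, and local computation is free. A maximal independent set is a set $I\subseteq V$ with no two nodes of $I$ adjacent such that every node outside $I$ has a neighbor in $I$; at the end every node must know whether it belongs to $I$. *)

theory Defs
  imports Main "HOL-Library.Discrete_Functions"
begin

text \<open>A graph is given by a vertex set V of natural numbers (the vertices are identified with
their unique identifiers) and an edge relation E.\<close>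

definition simple_graph :: "nat set \<Rightarrow> (nat \<Rightarrow> nat \<Rightarrow> bool) \<Rightarrow> bool" where
  "simple_graph V E \<longleftrightarrow> finite V \<and> V \<noteq> {} \<and>
     (\<forall>u v. E u v \<longrightarrow> u \<in> V \<and> v \<in> V) \<and>
     (\<forall>u v. E u v \<longrightarrow> E v u) \<and> (\<forall>u. \<not> E u u)"

definition walk :: "(nat \<Rightarrow> nat \<Rightarrow> bool) \<Rightarrow> nat list \<Rightarrow> bool" where
  "walk E xs \<longleftrightarrow> xs \<noteq> [] \<and> (\<forall>i. Suc i < length xs \<longrightarrow> E (xs ! i) (xs ! Suc i))"

definition reach_in :: "(nat \<Rightarrow> nat \<Rightarrow> bool) \<Rightarrow> nat \<Rightarrow> nat \<Rightarrow> nat \<Rightarrow> bool" where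
  "reach_in E k u v \<longleftrightarrow> (\<exists>xs. walk E xs \<and> hd xs = u \<and> last xs = v \<and> length xs = Suc k)"

definition connected_graph :: "nat set \<Rightarrow> (nat \<Rightarrow> nat \<Rightarrow> bool) \<Rightarrow> bool" where
  "connected_graph V E \<longleftrightarrow> (\<forall>u\<in>V. \<forall>v\<in>V. \<exists>k. reach_in E k u v)"

definition gdist :: "(nat \<Rightarrow> nat \<Rightarrow> bool) \<Rightarrow> nat \<Rightarrow> nat \<Rightarrow> nat" where
  "gdist E u v = (LEAST k. reach_in E k u v)"

definition diameter :: "nat set \<Rightarrow> (nat \<Rightarrow> nat \<Rightarrow> bool) \<Rightarrow> nat" where
  "diameter V E = Max {gdist E u v | u v. u \<in> V \<and> v \<in> V}"

definition nbrs :: "(nat \<Rightarrow> nat \<Rightarrow> bool) \<Rightarrow> nat \<Rightarrow> nat set" where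
  "nbrs E v = {u. E v u}"

definition maximal_independent_set ::
  "nat set \<Rightarrow> (nat \<Rightarrow> nat \<Rightarrow> bool) \<Rightarrow> nat set \<Rightarrow> bool" where
  "maximal_independent_set V E I \<longleftrightarrow> I \<subseteq> V \<and>
     (\<forall>u\<in>I. \<forall>v\<in>I. \<not> E u v) \<and>
     (\<forall>v\<in>V - I. \<exists>u\<in>I. E u v)"

text \<open>Messages are bit strings; None means "no message".
A round of received messages at a node maps each neighbour identifier to the message received
from it.  The history of a node is the list of all its rounds of received messages.
A deterministic algorithm consists of
  send :: own id \<Rightarrow> neighbour ids \<Rightarrow> history \<Rightarrow> target neighbour id \<Rightarrow> message option
  out  :: own id \<Rightarrow> neighbour ids \<Rightarrow> history \<Rightarrow> bool option  (None = undecided).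
Local computation is unrestricted (arbitrary functions of the local knowledge).\<close>

type_synonym msg = "bool list"
type_synonym inbox = "nat \<Rightarrow> msg option"
type_synonym send_fn = "nat \<Rightarrow> nat set \<Rightarrow> inbox list \<Rightarrow> nat \<Rightarrow> msg option"
type_synonym out_fn = "nat \<Rightarrow> nat set \<Rightarrow> inbox list \<Rightarrow> bool option"

fun hist :: "send_fn \<Rightarrow> (nat \<Rightarrow> nat \<Rightarrow> bool) \<Rightarrow> nat \<Rightarrow> nat \<Rightarrow> inbox list" where
  "hist sendf E 0 v = []"
| "hist sendf E (Suc t) v =
     hist sendf E t v @
       [(\<lambda>u. if E v u then sendf u (nbrs E u) (hist sendf E t u) v else None)]"

definition output_at :: "send_fn \<Rightarrow> out_fn \<Rightarrow> (nat \<Rightarrow> nat \<Rightarrow> bool) \<Rightarrow> nat \<Rightarrow> nat \<Rightarrow> bool option" where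
  "output_at sendf out E t v = out v (nbrs E v) (hist sendf E t v)"

definition msg_bounded :: "send_fn \<Rightarrow> (nat \<Rightarrow> nat \<Rightarrow> bool) \<Rightarrow> nat \<Rightarrow> bool" where
  "msg_bounded sendf E b \<longleftrightarrow>
     (\<forall>t u v m. E u v \<longrightarrow> sendf u (nbrs E u) (hist sendf E t u) v = Some m \<longrightarrow> length m \<le> b)"

text \<open>The algorithm computes an MIS of (V,E) within T rounds: outputs are never wrong
(a node that outputs a decision knows it), and after T rounds every node has decided.\<close>
definition computes_MIS_within ::
  "send_fn \<Rightarrow> out_fn \<Rightarrow> nat set \<Rightarrow> (nat \<Rightarrow> nat \<Rightarrow> bool) \<Rightarrow> nat \<Rightarrow> bool" where
  "computes_MIS_within sendf out V E T \<longleftrightarrow>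
     (\<exists>I. maximal_independent_set V E I \<and>
        (\<forall>v\<in>V. \<forall>t b. output_at sendf out E t v = Some b \<longrightarrow> b = (v \<in> I)) \<and>
        (\<forall>v\<in>V. output_at sendf out E T v = Some (v \<in> I)))"

end

theory Submission
  imports Defs
begin

text \<open>
  The algorithm derandomises a variant of Luby's algorithm in which an undecided vertex joins the
  independent set when its hash value is strictly smaller than those of its undecided neighbours.

  Let \<open>d v\<close> be the number of undecided neighbours of \<open>v\<close> and \<open>low v\<close> the set of those with
  degree at most \<open>d v\<close>. For a threshold \<open>t\<close> of about a \<open>1 / (9 * d v)\<close> fraction of the range,
  inclusion-exclusion bounds the indicator of ``\<open>v\<close> has a joining neighbour'' from below by the
  number of \<open>u \<in> low v\<close> with hash below \<open>t\<close>, minus the number of pairs of such \<open>u\<close>, minus the number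
  of edges from such \<open>u\<close> to further vertices with hash below \<open>t\<close>. Only pairs of hash values matter,
  so an affine hash \<open>x \<mapsto> (a * x + b) mod M\<close> with \<open>M\<close> polynomial in the largest identifier
  suffices, and no primality of \<open>M\<close> is needed, because the thresholds exceed all identifiers.
  Weighted by \<open>d v\<close> the estimators sum to a constant fraction of the number of edges on average,
  since every edge \<open>uv\<close> satisfies \<open>u \<in> low v\<close> or \<open>v \<in> low u\<close>. The \<open>O(log n)\<close> seed bits are fixed one
  by one with the method of conditional expectations: the two candidate sums are integers of
  \<open>O(log n)\<close> bits, added up along a BFS tree, and the root broadcasts the better bit. Hence
  \<open>O(log n)\<close> phases of \<open>O(D log n)\<close> rounds remove all edges.

  Neither \<open>n\<close> nor \<open>D\<close> is known. For \<open>H = 1, 2, 4, \<dots>\<close> the largest identifier is flooded for \<open>H\<close>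
  rounds, and disagreement between neighbours is flooded for \<open>2 * H\<close> rounds, after which either all
  vertices or none have heard of a disagreement; so all vertices stop at the same \<open>H \<le> 2 * D + 1\<close>.
  The largest identifier then serves as a polynomial bound for \<open>n\<close>.
\<close>

subsection \<open>Affine hashing\<close>

text \<open>A seed below \<open>M * M\<close> packs both coefficients as base-\<open>M\<close>
  digits, slope first, so that fixing the seed bit by bit fixes the whole hash function.\<close>

definition affine_hash :: "nat \<Rightarrow> nat \<Rightarrow> nat \<Rightarrow> nat" where
  "affine_hash M s x = ((s div M) * x + s mod M) mod M"

lemma sum_seeds:
  fixes f :: "nat \<Rightarrow> nat \<Rightarrow> 'a::comm_monoid_add"
  assumes "M > 0"
  shows "(\<Sum>s<M*M. f (s div M) (s mod M)) = (\<Sum>a<M. \<Sum>b<M. f a b)"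
proof -
  have "(\<Sum>s<M*M. f (s div M) (s mod M)) = (\<Sum>a<M. \<Sum>s\<in>{a*M..<a*M+M}. f (s div M) (s mod M))"
    by (rule sum.nat_group[symmetric])
  also have "\<dots> = (\<Sum>a<M. \<Sum>b<M. f a b)"
  proof (rule sum.cong[OF refl])
    fix a
    have "(\<Sum>s\<in>{a*M..<a*M+M}. f (s div M) (s mod M)) = (\<Sum>s\<in>{0+a*M..<M+a*M}. f (s div M) (s mod M))"
      by (simp add: add.commute)
    also have "\<dots> = (\<Sum>b\<in>{0..<M}. f ((b+a*M) div M) ((b+a*M) mod M))"
      by (rule sum.shift_bounds_nat_ivl)
    also have "\<dots> = (\<Sum>b\<in>{0..<M}. f a b)" using assms by (intro sum.cong) auto
    finally show "(\<Sum>s\<in>{a*M..<a*M+M}. f (s div M) (s mod M)) = (\<Sum>b<M. f a b)"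
      by (simp add: atLeast0LessThan)
  qed
  finally show ?thesis .
qed

text \<open>Translation by \<open>c\<close> permutes the residues modulo \<open>M\<close>.\<close>

lemma sum_shift_mod:
  fixes g :: "nat \<Rightarrow> 'a::comm_monoid_add"
  assumes "M > 0"
  shows "(\<Sum>b<M. g ((c + b) mod M)) = (\<Sum>b<M. g b)"
proof -
  have inj: "inj_on (\<lambda>b. (c + b) mod M) {..<M}"
  proof (rule inj_onI)
    fix x y assume xy: "x \<in> {..<M}" "y \<in> {..<M}" "(c + x) mod M = (c + y) mod M"
    then have "int (c + x) mod int M = int (c + y) mod int M" by (metis zmod_int)
    then have "int M dvd int (c + x) - int (c + y)" by (simp add: mod_eq_dvd_iff)
    then have "int M dvd int x - int y" by simp
    with xy show "x = y"
      by (smt (verit, ccfv_SIG) lessThan_iff of_nat_eq_iff of_nat_less_iff of_nat_0_le_iff zdvd_not_zless dvd_minus_iff)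
  qed
  have sub: "(\<lambda>b. (c + b) mod M) ` {..<M} \<subseteq> {..<M}" using assms by auto
  then have img: "(\<lambda>b. (c + b) mod M) ` {..<M} = {..<M}"
    using inj by (simp add: endo_inj_surj)
  show ?thesis using sum.reindex[OF inj, of g] img by simp
qed

text \<open>For each fixed slope the offset alone makes the hash value of \<open>x\<close>
  uniform.\<close>

lemma sum_affine_hash_single:
  assumes "M > 0" "t \<le> M"
  shows "(\<Sum>s<M*M. of_bool (affine_hash M s x < t)) = M * t"
proof -
  have "(\<Sum>s<M*M. of_bool (affine_hash M s x < t))
     = (\<Sum>a<M. \<Sum>b<M. (of_bool ((a * x + b) mod M < t) :: nat))"
    unfolding affine_hash_def
    by (rule sum_seeds[OF assms(1), of "\<lambda>a b. of_bool ((a * x + b) mod M < t)"])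
  also have "\<dots> = (\<Sum>a<M. \<Sum>b<M. of_bool (b < t))"
    by (intro sum.cong refl sum_shift_mod[OF assms(1), of "\<lambda>r. of_bool (r < t)"])
  also have "(\<Sum>b<M. of_bool (b < t)) = t"
  proof -
    have "{..<M} \<inter> {b. b < t} = {..<t}" using assms by auto
    then show ?thesis by (simp add: of_bool_def sum.If_cases)
  qed
  finally show ?thesis by simp
qed

text \<open>Two members of the progression in a window of length \<open>t\<close> differ by at most
  \<open>t\<close>, so their indices differ by at most \<open>t div z\<close>.\<close>

lemma card_progression_in_interval:
  fixes z :: nat
  assumes "z > 0"
  shows "finite {a. l \<le> r + a * z \<and> r + a * z < l + t}"
    and "card {a. l \<le> r + a * z \<and> r + a * z < l + t} \<le> t div z + 1"
proof -
  let ?S = "{a. l \<le> r + a * z \<and> r + a * z < l + t}"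
  have "\<exists>a0. ?S \<subseteq> {a0..a0 + t div z}"
  proof (cases "?S = {}")
    case False
    define a0 where "a0 = (LEAST a. a \<in> ?S)"
    have a0: "a0 \<in> ?S" unfolding a0_def using False by (metis (mono_tags) LeastI ex_in_conv)
    have "a \<in> {a0..a0 + t div z}" if a: "a \<in> ?S" for a
    proof -
      have le: "a0 \<le> a" unfolding a0_def using a by (rule Least_le)
      have "(a - a0) * z = a * z - a0 * z" by (simp add: diff_mult_distrib)
      also have "\<dots> \<le> t" using a a0 by auto
      finally have "a - a0 \<le> t div z" using assms by (simp add: less_eq_div_iff_mult_less_eq)
      then show ?thesis using le by auto
    qed
    then show ?thesis by blast
  qed (metis empty_subsetI)
  then obtain a0 where sub: "?S \<subseteq> {a0..a0 + t div z}" by blast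
  show "finite ?S" using sub by (rule finite_subset) simp
  show "card ?S \<le> t div z + 1" using card_mono[OF _ sub] by simp
qed

text \<open>For \<open>a < M\<close> the value \<open>r + a * z\<close> stays below
  \<open>M * (z + 1)\<close>, so only the \<open>z + 1\<close> windows of length \<open>t\<close>
  that start at multiples of \<open>M\<close> matter. Each holds at most \<open>t div z + 1\<close>
  members of the progression.\<close>

lemma card_progression_mod:
  fixes z :: nat
  assumes "z > 0" "r < M"
  shows "card {a. a < M \<and> (r + a * z) mod M < t} \<le> 2 * t + z + 1"
proof -
  let ?I = "\<lambda>j. {a. j * M \<le> r + a * z \<and> r + a * z < j * M + t}"
  have "{a. a < M \<and> (r + a * z) mod M < t} \<subseteq> (\<Union>j\<le>z. ?I j)"
  proof
    fix a assume a: "a \<in> {a. a < M \<and> (r + a * z) mod M < t}"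
    let ?j = "(r + a * z) div M"
    have "a * z \<le> (M - 1) * z" using a by (intro mult_right_mono) auto
    then have "r + a * z < M + (M - 1) * z" using assms(2) by linarith
    also have "\<dots> \<le> M * (z + 1)" by (simp add: algebra_simps)
    finally have "?j < z + 1" by (simp add: less_mult_imp_div_less mult.commute)
    then have "?j \<in> {..z}" by simp
    moreover have "a \<in> ?I ?j"
    proof -
      define n where "n = r + a * z"
      have "n div M * M + n mod M = n" "n mod M < t" using a by (auto simp: n_def)
      then have "n div M * M \<le> n \<and> n < n div M * M + t" by linarith
      then show ?thesis by (simp add: n_def)
    qed
    ultimately show "a \<in> (\<Union>j\<le>z. ?I j)" by (rule UN_I)
  qed
  then have "card {a. a < M \<and> (r + a * z) mod M < t} \<le> card (\<Union>j\<le>z. ?I j)"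
    by (intro card_mono finite_UN_I card_progression_in_interval(1)[OF assms(1)]) auto
  also have "\<dots> \<le> (\<Sum>j\<le>z. card (?I j))" by (rule card_UN_le) simp
  also have "\<dots> \<le> (\<Sum>j\<le>z. t div z + 1)"
    by (intro sum_mono card_progression_in_interval(2)[OF assms(1)])
  also have "\<dots> = z * (t div z) + t div z + z + 1" by (simp add: algebra_simps)
  also have "\<dots> \<le> t + t + z + 1" by (intro add_mono) auto
  finally show ?thesis by simp
qed

text \<open>Let \<open>r\<close> be the hash value of \<open>x\<close>; that of \<open>y\<close> is
  \<open>r + a * z\<close> modulo \<open>M\<close>. For fixed slope \<open>a\<close> the value
  \<open>r\<close> is uniform, so after swapping the sums it remains to count, for each of the
  \<open>t\<close> values \<open>r < t\<close>, the slopes that bring \<open>y\<close> below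
  \<open>t\<close>. There are at most \<open>2 * t + z + 1\<close> of them, which is at most
  \<open>3 * t\<close> since \<open>z < t\<close>. This replaces pairwise independence up to the
  factor 3.\<close>

lemma sum_affine_hash_pair_less:
  assumes "M > 0" "t \<le> M" "x < y" "y - x < t"
  shows "(\<Sum>s<M*M. of_bool (affine_hash M s x < t) * of_bool (affine_hash M s y < t)) \<le> 3 * t * t"
proof -
  define z where "z = y - x"
  have z: "z > 0" "z < t" "y = x + z" using assms by (auto simp: z_def)
  let ?g = "\<lambda>a r. of_bool (r < t) * of_bool ((r + a * z) mod M < t) :: nat"
  have "(\<Sum>s<M*M. of_bool (affine_hash M s x < t) * of_bool (affine_hash M s y < t))
     = (\<Sum>a<M. \<Sum>b<M. (of_bool ((a * x + b) mod M < t) * of_bool ((a * y + b) mod M < t) :: nat))"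
    unfolding affine_hash_def
    by (rule sum_seeds[OF assms(1), of "\<lambda>a b. of_bool ((a * x + b) mod M < t) * of_bool ((a * y + b) mod M < t)"])
  also have "\<dots> = (\<Sum>a<M. \<Sum>b<M. ?g a ((a * x + b) mod M))"
  proof -
    have "(a * y + b) mod M = ((a * x + b) mod M + a * z) mod M" for a b
      by (simp add: z(3) algebra_simps mod_simps)
    then show ?thesis by simp
  qed
  also have "\<dots> = (\<Sum>a<M. \<Sum>r<M. ?g a r)"
    by (intro sum.cong refl sum_shift_mod[OF assms(1)])
  also have "\<dots> = (\<Sum>r<M. \<Sum>a<M. ?g a r)" by (rule sum.swap)
  also have "\<dots> = (\<Sum>r<M. of_bool (r < t) * card {a. a < M \<and> (r + a * z) mod M < t})"
  proof (intro sum.cong refl)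
    fix r
    have "{..<M} \<inter> {a. (r + a * z) mod M < t} = {a. a < M \<and> (r + a * z) mod M < t}" by auto
    then have "(\<Sum>a<M. of_bool ((r + a * z) mod M < t)) = card {a. a < M \<and> (r + a * z) mod M < t}"
      by (simp add: of_bool_def sum.If_cases)
    then show "(\<Sum>a<M. ?g a r) = of_bool (r < t) * card {a. a < M \<and> (r + a * z) mod M < t}"
      by (simp add: sum_distrib_left[symmetric])
  qed
  also have "\<dots> \<le> (\<Sum>r<M. of_bool (r < t) * (3 * t))"
  proof (intro sum_mono mult_left_mono)
    fix r assume "r \<in> {..<M}"
    then show "card {a. a < M \<and> (r + a * z) mod M < t} \<le> 3 * t"
      using card_progression_mod[of z r M t] z by auto
  qed auto
  also have "\<dots> = 3 * t * t"
  proof -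
    have "{..<M} \<inter> {b. b < t} = {..<t}" using assms by auto
    then have "(\<Sum>b<M. of_bool (b < t)) = t" by (simp add: of_bool_def sum.If_cases)
    then show ?thesis by (simp add: sum_distrib_right[symmetric])
  qed
  finally show ?thesis .
qed

lemma sum_affine_hash_pair:
  assumes "M > 0" "t \<le> M" "x \<noteq> y" "x < t" "y < t"
  shows "(\<Sum>s<M*M. of_bool (affine_hash M s x < t) * of_bool (affine_hash M s y < t)) \<le> 3 * t * t"
proof (cases "x < y")
  case True
  then show ?thesis using sum_affine_hash_pair_less[of M t x y] assms by auto
next
  case False
  then show ?thesis using sum_affine_hash_pair_less[of M t y x] assms by (auto simp: mult.commute)
qed

subsection \<open>The estimator for removed edges\<close>

definition hit :: "nat \<Rightarrow> nat \<Rightarrow> nat \<Rightarrow> nat \<Rightarrow> nat" where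
  "hit M s d u = of_bool (affine_hash M s u < M div (9 * d))"

text \<open>The positive part of the estimator at \<open>v\<close>. The factor \<open>d v\<close>
  makes the sum over removed vertices count their edges.\<close>

definition gain :: "nat \<Rightarrow> nat set \<Rightarrow> (nat \<Rightarrow> nat) \<Rightarrow> nat \<Rightarrow> nat \<Rightarrow> nat" where
  "gain M N d v s = d v * (\<Sum>u\<in>{u \<in> N. d u \<le> d v}. hit M s (d v) u)"

text \<open>The first sum is what \<open>v\<close> contributes to the estimators of its neighbours \<open>x\<close>: charged to \<open>v\<close>, it
  only involves neighbours of \<open>v\<close>, whereas \<open>x\<close> does not know the neighbours of \<open>v\<close>.\<close>
definition loss :: "nat \<Rightarrow> nat set \<Rightarrow> (nat \<Rightarrow> nat) \<Rightarrow> nat \<Rightarrow> nat \<Rightarrow> nat" where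
  "loss M N d v s =
     (\<Sum>x\<in>{x \<in> N. d v \<le> d x}. d x * (\<Sum>w\<in>N. hit M s (d x) v * hit M s (d x) w)) +
     d v * (\<Sum>u\<in>{u \<in> N. d u \<le> d v}. \<Sum>w\<in>{w \<in> N. d w \<le> d v} - {u}. hit M s (d v) u * hit M s (d v) w)"

lemma gain_cong:
  assumes "\<And>u. u \<in> insert v N \<Longrightarrow> d u = d' u"
  shows "gain M N d v s = gain M N d' v s"
proof -
  have *: "{u \<in> N. d u \<le> d v} = {u \<in> N. d' u \<le> d' v}" using assms by auto
  show ?thesis unfolding gain_def * using assms by simp
qed

lemma loss_cong:
  assumes "\<And>u. u \<in> insert v N \<Longrightarrow> d u = d' u"
  shows "loss M N d v s = loss M N d' v s"
proof -
  have 1: "{u \<in> N. d u \<le> d v} = {u \<in> N. d' u \<le> d' v}"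
   and 2: "{u \<in> N. d v \<le> d u} = {u \<in> N. d' v \<le> d' u}" using assms by auto
  show ?thesis unfolding loss_def 1 2 using assms by simp
qed

lemma hit_le: "hit M s d u \<le> 1"
  by (simp add: hit_def)

text \<open>This crude polynomial bound and the one for \<open>loss\<close> ensure that the sums
  sent along the tree have few bits.\<close>

lemma gain_le:
  assumes "finite N" "card N \<le> n" "\<And>u. u \<in> insert v N \<Longrightarrow> d u \<le> n"
  shows "gain M N d v s \<le> n * n"
proof -
  have "(\<Sum>u\<in>{u \<in> N. d u \<le> d v}. hit M s (d v) u) \<le> (\<Sum>u\<in>{u \<in> N. d u \<le> d v}. 1)"
    by (intro sum_mono hit_le)
  also have "\<dots> \<le> card N" using assms(1) by (auto intro: card_mono)
  finally show ?thesis unfolding gain_def using assms by (intro mult_mono) auto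
qed

lemma loss_le:
  assumes "finite N" "card N \<le> n" "\<And>u. u \<in> insert v N \<Longrightarrow> d u \<le> n"
  shows "loss M N d v s \<le> 2 * (n * n * n)"
proof -
  have sub: "card S \<le> n" if "S \<subseteq> N" for S
    using card_mono[OF assms(1) that] assms(2) by simp
  have card: "card {u \<in> N. P u} \<le> n" for P by (rule sub) auto
  have hh: "hit M s x u * hit M s y w \<le> 1" for x y u w by (simp add: hit_def)
  have "(\<Sum>x\<in>{x \<in> N. d v \<le> d x}. d x * (\<Sum>w\<in>N. hit M s (d x) v * hit M s (d x) w))
     \<le> (\<Sum>x\<in>{x \<in> N. d v \<le> d x}. n * n)"
  proof (intro sum_mono mult_mono)
    fix x assume "x \<in> {x \<in> N. d v \<le> d x}"
    then show "d x \<le> n" using assms(3) by simp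
    have "(\<Sum>w\<in>N. hit M s (d x) v * hit M s (d x) w) \<le> (\<Sum>w\<in>N. 1)" by (intro sum_mono hh)
    then show "(\<Sum>w\<in>N. hit M s (d x) v * hit M s (d x) w) \<le> n" using assms(2) by simp
  qed auto
  also have "\<dots> \<le> n * (n * n)" using card by (simp add: mult_right_mono)
  finally have 1: "(\<Sum>x\<in>{x \<in> N. d v \<le> d x}. d x * (\<Sum>w\<in>N. hit M s (d x) v * hit M s (d x) w)) \<le> n * (n * n)" .
  let ?L = "{u \<in> N. d u \<le> d v}"
  have "(\<Sum>u\<in>?L. \<Sum>w\<in>?L - {u}. hit M s (d v) u * hit M s (d v) w) \<le> (\<Sum>u\<in>?L. \<Sum>w\<in>?L - {u}. 1)"
    by (intro sum_mono hh)
  also have "\<dots> \<le> (\<Sum>u\<in>?L. n)" using card by (intro sum_mono) (simp add: diff_le_self[THEN order_trans])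
  also have "\<dots> \<le> n * n" using card by (simp add: mult_right_mono)
  finally have 2: "d v * (\<Sum>u\<in>?L. \<Sum>w\<in>?L - {u}. hit M s (d v) u * hit M s (d v) w) \<le> n * (n * n)"
    using assms(3) by (intro mult_mono) auto
  show ?thesis unfolding loss_def using 1 2 by (simp add: mult.assoc)
qed

text \<open>\<open>A\<close> stands for the undecided vertices. The relation \<open>E\<close> is not
  confined to \<open>A\<close>; the restriction takes place in the neighbourhoods
  \<open>N\<close>.\<close>

locale active_graph =
  fixes A :: "nat set" and E :: "nat \<Rightarrow> nat \<Rightarrow> bool"
  assumes finite_A: "finite A"
    and E_sym: "E u v \<Longrightarrow> E v u"
    and E_irrefl: "\<not> E u u"
begin

definition N :: "nat \<Rightarrow> nat set" where "N v = {u \<in> A. E v u}"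
definition d :: "nat \<Rightarrow> nat" where "d v = card (N v)"
definition low :: "nat \<Rightarrow> nat set" where "low v = {u \<in> N v. d u \<le> d v}"

text \<open>The vertices with a joining neighbour, where joining means being a strict local minimum
  of \<open>h\<close>. The joining vertices themselves are not counted.\<close>

definition removed :: "(nat \<Rightarrow> nat) \<Rightarrow> nat set" where
  "removed h = {v \<in> A. \<exists>u\<in>N v. \<forall>w\<in>N u. h u < h w}"

lemma finite_N [simp]: "finite (N v)" unfolding N_def using finite_A by simp
lemma finite_low [simp]: "finite (low v)" unfolding low_def by simp
lemma card_low_le: "card (low v) \<le> d v"
  unfolding d_def low_def by (intro card_mono) auto

text \<open>Let \<open>k\<close> low neighbours hash below \<open>t\<close>; the ordered pairs of
  them number \<open>k * (k - 1)\<close>. If \<open>v\<close> is removed,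
  \<open>k \<le> 1 + k * (k - 1)\<close> suffices. Otherwise none of the \<open>k\<close> joins, so
  each has a neighbour with a hash value that is no larger, hence also below \<open>t\<close>, and
  the sum over edges is already at least \<open>k\<close>.\<close>

lemma estimator_le_removed:
  fixes h :: "nat \<Rightarrow> nat" and t :: nat
  assumes "v \<in> A"
  shows "(\<Sum>u\<in>low v. of_bool (h u < t)) \<le> of_bool (v \<in> removed h) +
     (\<Sum>u\<in>low v. \<Sum>w\<in>N u. of_bool (h u < t) * of_bool (h w < t)) +
     (\<Sum>u\<in>low v. \<Sum>w\<in>low v - {u}. of_bool (h u < t) * (of_bool (h w < t) :: nat))"
    (is "?S \<le> _ + ?B + ?P")
proof -
  define K where "K = {u \<in> low v. h u < t}"
  have fK: "finite K" unfolding K_def by simp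
  have S: "?S = card K"
  proof -
    have "low v \<inter> {u. h u < t} = K" unfolding K_def by auto
    then show ?thesis by (simp add: of_bool_def sum.If_cases)
  qed
  have P: "?P = card K * (card K - 1)"
  proof -
    have "(\<Sum>w\<in>low v - {u}. of_bool (h u < t) * (of_bool (h w < t) :: nat))
        = (if h u < t then card K - 1 else 0)" if "u \<in> low v" for u
    proof -
      have "(low v - {u}) \<inter> {w. h w < t} = K - {u}" unfolding K_def by auto
      then have "(\<Sum>w\<in>low v - {u}. (of_bool (h w < t) :: nat)) = card (K - {u})"
        by (simp add: of_bool_def sum.If_cases)
      then show ?thesis using that fK by (auto simp: K_def)
    qed
    then have "?P = (\<Sum>u\<in>low v. if h u < t then card K - 1 else 0)" by simp
    also have "\<dots> = (\<Sum>u\<in>K. card K - 1)"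
      unfolding K_def by (rule sum.inter_filter[symmetric]) simp
    finally show ?thesis by simp
  qed
  show ?thesis
  proof (cases "v \<in> removed h")
    case True
    have "card K \<le> 1 + card K * (card K - 1)"
      by (cases "card K") auto
    then show ?thesis using True S P by simp
  next
    case False
    have "?S \<le> ?B"
    proof (rule sum_mono)
      fix u assume u: "u \<in> low v"
      show "of_bool (h u < t) \<le> (\<Sum>w\<in>N u. of_bool (h u < t) * (of_bool (h w < t) :: nat))"
      proof (cases "h u < t")
        case True
        have "u \<in> N v" using u by (simp add: low_def)
        then obtain w where w: "w \<in> N u" "h w \<le> h u"
          using False assms unfolding removed_def by (auto simp: not_less)
        have "of_bool (h w < t) \<le> (\<Sum>w\<in>N u. (of_bool (h w < t) :: nat))"
          using w(1) by (intro member_le_sum) auto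
        then show ?thesis using True w by simp
      qed simp
    qed
    then show ?thesis by linarith
  qed
qed

text \<open>Swapping the order of summation over adjacent pairs moves each term from the vertex that
  can compute it to the vertex whose estimator it belongs to.\<close>

lemma sum_loss:
  "(\<Sum>v\<in>A. loss M (N v) d v s) =
   (\<Sum>v\<in>A. d v * ((\<Sum>u\<in>low v. \<Sum>w\<in>N u. hit M s (d v) u * hit M s (d v) w) +
      (\<Sum>u\<in>low v. \<Sum>w\<in>low v - {u}. hit M s (d v) u * hit M s (d v) w)))"
proof -
  let ?f = "\<lambda>x v. d x * (\<Sum>w\<in>N v. hit M s (d x) v * hit M s (d x) w)"
  have "(\<Sum>v\<in>A. \<Sum>x\<in>{x \<in> N v. d v \<le> d x}. ?f x v) = (\<Sum>v\<in>A. \<Sum>x\<in>{x \<in> A. E v x \<and> d v \<le> d x}. ?f x v)"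
    by (simp add: N_def conj_assoc)
  also have "\<dots> = (\<Sum>x\<in>A. \<Sum>v\<in>{v \<in> A. E v x \<and> d v \<le> d x}. ?f x v)"
    using finite_A by (intro sum.swap_restrict)
  also have "\<dots> = (\<Sum>x\<in>A. \<Sum>v\<in>low x. ?f x v)"
  proof -
    have "{v \<in> A. E v x \<and> d v \<le> d x} = low x" for x
      unfolding low_def N_def using E_sym by auto
    then show ?thesis by simp
  qed
  also have "\<dots> = (\<Sum>x\<in>A. d x * (\<Sum>v\<in>low x. \<Sum>w\<in>N v. hit M s (d x) v * hit M s (d x) w))"
    by (simp add: sum_distrib_left)
  finally show ?thesis
    unfolding loss_def by (simp add: sum.distrib low_def algebra_simps)
qed

lemma sum_gain_le:
  "(\<Sum>v\<in>A. gain M (N v) d v s) \<le>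
     (\<Sum>v\<in>removed (affine_hash M s). d v) + (\<Sum>v\<in>A. loss M (N v) d v s)"
proof -
  let ?h = "affine_hash M s"
  have "(\<Sum>v\<in>A. gain M (N v) d v s) = (\<Sum>v\<in>A. d v * (\<Sum>u\<in>low v. hit M s (d v) u))"
    by (simp add: gain_def low_def)
  also have "\<dots> \<le> (\<Sum>v\<in>A. d v * (of_bool (v \<in> removed ?h) +
     (\<Sum>u\<in>low v. \<Sum>w\<in>N u. hit M s (d v) u * hit M s (d v) w) +
     (\<Sum>u\<in>low v. \<Sum>w\<in>low v - {u}. hit M s (d v) u * hit M s (d v) w)))"
    unfolding hit_def by (intro sum_mono mult_left_mono estimator_le_removed) auto
  also have "\<dots> = (\<Sum>v\<in>A. d v * of_bool (v \<in> removed ?h)) + (\<Sum>v\<in>A. loss M (N v) d v s)"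
    unfolding sum_loss by (simp add: sum.distrib algebra_simps)
  also have "(\<Sum>v\<in>A. d v * of_bool (v \<in> removed ?h)) = (\<Sum>v\<in>removed ?h. d v)"
  proof -
    have "removed ?h = {v \<in> A. v \<in> removed ?h}" unfolding removed_def by auto
    then have "(\<Sum>v\<in>removed ?h. d v) = (\<Sum>v\<in>A. if v \<in> removed ?h then d v else 0)"
      using sum.inter_filter[OF finite_A, of d "\<lambda>v. v \<in> removed ?h"] by simp
    then show ?thesis by (simp add: of_bool_def if_distrib cong: if_cong)
  qed
  finally show ?thesis .
qed

text \<open>A neighbour outside \<open>low v\<close> has \<open>v\<close> in its own low set, so
  after swapping the summation both halves of each neighbourhood are counted by
  \<open>low\<close>.\<close>

lemma sum_d_le_low: "(\<Sum>v\<in>A. d v) \<le> 2 * (\<Sum>v\<in>A. card (low v))"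
proof -
  have c: "card {u \<in> A. E v u \<and> d u \<le> d v} = card (low v)" for v
    unfolding low_def N_def by (simp add: conj_assoc)
  have "(\<Sum>v\<in>A. d v) \<le> (\<Sum>v\<in>A. card {u \<in> A. E v u \<and> d u \<le> d v} + card {u \<in> A. E v u \<and> d v \<le> d u})"
  proof (rule sum_mono)
    fix v
    have "N v = {u \<in> A. E v u \<and> d u \<le> d v} \<union> {u \<in> A. E v u \<and> d v \<le> d u}"
      unfolding N_def by auto
    then have "card (N v) \<le> card {u \<in> A. E v u \<and> d u \<le> d v} + card {u \<in> A. E v u \<and> d v \<le> d u}"
      by (simp only: card_Un_le)
    then show "d v \<le> card {u \<in> A. E v u \<and> d u \<le> d v} + card {u \<in> A. E v u \<and> d v \<le> d u}"
      by (simp only: d_def[of v, symmetric])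
  qed
  also have "\<dots> = (\<Sum>v\<in>A. card (low v)) + (\<Sum>v\<in>A. \<Sum>u\<in>{u \<in> A. E v u \<and> d v \<le> d u}. 1)"
    by (simp add: sum.distrib c)
  also have "(\<Sum>v\<in>A. \<Sum>u\<in>{u \<in> A. E v u \<and> d v \<le> d u}. 1) = (\<Sum>u\<in>A. \<Sum>v\<in>{v \<in> A. E v u \<and> d v \<le> d u}. (1::nat))"
    using finite_A by (intro sum.swap_restrict)
  also have "\<dots> = (\<Sum>u\<in>A. card (low u))"
  proof -
    have "{v \<in> A. E v u \<and> d v \<le> d u} = {v \<in> A. E u v \<and> d v \<le> d u}" for u using E_sym by auto
    then show ?thesis by (simp add: c)
  qed
  finally show ?thesis by simp
qed

text \<open>The threshold \<open>t = M div (9 * d v)\<close> exceeds every identifier, so that pairs collide below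
  it for at most \<open>3 * t\<^sup>2\<close> of the \<open>M\<^sup>2\<close> seeds.\<close>
lemma vertex_expectation:
  assumes M: "9 * d v * K \<le> M" and K: "\<And>u. u \<in> A \<Longrightarrow> u < K" and v: "v \<in> A"
  shows "card (low v) * (M * M) + 54 * d v * (\<Sum>s<M*M.
      (\<Sum>u\<in>low v. \<Sum>w\<in>N u. hit M s (d v) u * hit M s (d v) w) +
      (\<Sum>u\<in>low v. \<Sum>w\<in>low v - {u}. hit M s (d v) u * hit M s (d v) w))
    \<le> 54 * d v * (\<Sum>s<M*M. \<Sum>u\<in>low v. hit M s (d v) u)"
proof (cases "d v = 0")
  case True
  then have "low v = {}" using card_low_le[of v] by simp
  then show ?thesis by simp
next
  case False
  define t where "t = M div (9 * d v)"
  define l where "l = card (low v)"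
  have K0: "K > 0" using K[OF v] by simp
  have M9: "9 * d v * 1 \<le> M" by (rule order_trans[OF mult_left_mono M]) (use K0 in auto)
  then have M0: "M > 0" using False by linarith
  have tK: "K \<le> t" unfolding t_def using M False by (simp add: less_eq_div_iff_mult_less_eq mult.commute)
  have t9: "9 * (d v * t) \<le> M" unfolding t_def by (metis mult.assoc times_div_less_eq_dividend)
  have tM: "t \<le> M" unfolding t_def by simp
  \<comment> \<open>Since \<open>t \<ge> 1\<close>, the remainder of the division is below
    \<open>9 * d v * t\<close>, so rounding loses at most a factor 2.\<close>
  have t18: "M \<le> 18 * (d v * t)"
  proof -
    have "M = 9 * d v * t + M mod (9 * d v)" unfolding t_def by simp
    moreover have "M mod (9 * d v) < 9 * d v" using False by simp
    moreover have "9 * d v * 1 \<le> 9 * d v * t" using tK K0 by (intro mult_left_mono) auto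
    ultimately show ?thesis by linarith
  qed
  have pair: "(\<Sum>s<M*M. hit M s (d v) u * hit M s (d v) w) \<le> 3 * t * t"
    if "u \<in> A" "w \<in> A" "u \<noteq> w" for u w
    unfolding hit_def t_def[symmetric]
    using sum_affine_hash_pair[OF M0 tM that(3)] K that tK by (meson order_less_le_trans)
  have lowA: "low v \<subseteq> A" "N u \<subseteq> A" for u unfolding low_def N_def by auto
  have B: "(\<Sum>s<M*M. \<Sum>u\<in>low v. \<Sum>w\<in>N u. hit M s (d v) u * hit M s (d v) w) \<le> l * (d v * (3 * t * t))"
  proof -
    have "(\<Sum>s<M*M. \<Sum>u\<in>low v. \<Sum>w\<in>N u. hit M s (d v) u * hit M s (d v) w)
        = (\<Sum>u\<in>low v. \<Sum>w\<in>N u. \<Sum>s<M*M. hit M s (d v) u * hit M s (d v) w)"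
      by (subst sum.swap, rule sum.cong[OF refl], rule sum.swap)
    also have "\<dots> \<le> (\<Sum>u\<in>low v. \<Sum>w\<in>N u. 3 * t * t)"
      using lowA E_irrefl by (intro sum_mono pair) (auto simp: N_def)
    also have "\<dots> = (\<Sum>u\<in>low v. d u * (3 * t * t))" by (simp add: d_def)
    also have "\<dots> \<le> (\<Sum>u\<in>low v. d v * (3 * t * t))"
      by (intro sum_mono mult_right_mono) (auto simp: low_def)
    finally show ?thesis by (simp add: l_def)
  qed
  have P: "(\<Sum>s<M*M. \<Sum>u\<in>low v. \<Sum>w\<in>low v - {u}. hit M s (d v) u * hit M s (d v) w) \<le> l * (d v * (3 * t * t))"
  proof -
    have "(\<Sum>s<M*M. \<Sum>u\<in>low v. \<Sum>w\<in>low v - {u}. hit M s (d v) u * hit M s (d v) w)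
        = (\<Sum>u\<in>low v. \<Sum>w\<in>low v - {u}. \<Sum>s<M*M. hit M s (d v) u * hit M s (d v) w)"
      by (subst sum.swap, rule sum.cong[OF refl], rule sum.swap)
    also have "\<dots> \<le> (\<Sum>u\<in>low v. \<Sum>w\<in>low v - {u}. 3 * t * t)"
      using lowA by (intro sum_mono pair) auto
    also have "\<dots> = (\<Sum>u\<in>low v. card (low v - {u}) * (3 * t * t))" by simp
    also have "\<dots> \<le> (\<Sum>u\<in>low v. d v * (3 * t * t))"
      using card_low_le[of v] card_Diff1_le[of "low v"] by (intro sum_mono mult_right_mono) (auto intro: order_trans)
    finally show ?thesis by (simp add: l_def)
  qed
  have S: "(\<Sum>s<M*M. \<Sum>u\<in>low v. hit M s (d v) u) = l * (M * t)"
  proof -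
    have "(\<Sum>s<M*M. \<Sum>u\<in>low v. hit M s (d v) u) = (\<Sum>u\<in>low v. \<Sum>s<M*M. hit M s (d v) u)"
      by (rule sum.swap)
    also have "\<dots> = (\<Sum>u\<in>low v. M * t)"
      unfolding hit_def t_def[symmetric] using sum_affine_hash_single[OF M0 tM] by simp
    finally show ?thesis by (simp add: l_def)
  qed
  define y where "y = d v * t"
  \<comment> \<open>Here \<open>y\<close> lies between \<open>M / 18\<close> and
    \<open>M / 9\<close>. The upper bound gives \<open>M \<le> 3 * (M - 6 * y)\<close>, the lower
    one \<open>M \<le> 18 * y\<close>; the product is the claim. The 324 is 54 times the two loss
    sums with factor 3 each.\<close>
  have key: "M * M + 324 * (y * y) \<le> 54 * y * M"
  proof -
    have "int M * int M \<le> (18 * int y) * (3 * (int M - 6 * int y))"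
      using t9 t18 unfolding y_def[symmetric] by (intro mult_mono) auto
    then have "int (M * M + 324 * (y * y)) \<le> int (54 * y * M)" by (simp add: algebra_simps)
    then show ?thesis by (simp only: of_nat_le_iff)
  qed
  have "l * (M * M) + 54 * d v * (l * (d v * (3 * t * t)) + l * (d v * (3 * t * t)))
      = l * (M * M + 324 * (y * y))" unfolding y_def by (simp add: algebra_simps)
  also have "\<dots> \<le> l * (54 * y * M)" using key by (rule mult_left_mono) simp
  also have "\<dots> = 54 * d v * (l * (M * t))" unfolding y_def by (simp add: algebra_simps)
  finally have fin: "l * (M * M) + 54 * d v * (l * (d v * (3 * t * t)) + l * (d v * (3 * t * t)))
      \<le> 54 * d v * (l * (M * t))" .
  have "54 * d v * (\<Sum>s<M*M.
      (\<Sum>u\<in>low v. \<Sum>w\<in>N u. hit M s (d v) u * hit M s (d v) w) +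
      (\<Sum>u\<in>low v. \<Sum>w\<in>low v - {u}. hit M s (d v) u * hit M s (d v) w))
    \<le> 54 * d v * (l * (d v * (3 * t * t)) + l * (d v * (3 * t * t)))"
    unfolding sum.distrib using B P by (intro mult_left_mono add_mono) auto
  then show ?thesis unfolding S l_def[symmetric] using fin by linarith
qed

text \<open>The bounds for single vertices are added up, and passing from low neighbours to all
  neighbours doubles 54 to 108. Thus the average over all seeds of gain minus loss is at least 1/108
  of the degree sum.\<close>

lemma expectation:
  assumes M: "\<And>v. v \<in> A \<Longrightarrow> 9 * d v * K \<le> M" and K: "\<And>u. u \<in> A \<Longrightarrow> u < K"
  shows "(\<Sum>v\<in>A. d v) * (M * M) + 108 * (\<Sum>s<M*M. \<Sum>v\<in>A. loss M (N v) d v s)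
    \<le> 108 * (\<Sum>s<M*M. \<Sum>v\<in>A. gain M (N v) d v s)"
proof -
  let ?L = "\<lambda>v s. (\<Sum>u\<in>low v. \<Sum>w\<in>N u. hit M s (d v) u * hit M s (d v) w) +
      (\<Sum>u\<in>low v. \<Sum>w\<in>low v - {u}. hit M s (d v) u * hit M s (d v) w)"
  have loss: "54 * (\<Sum>s<M*M. \<Sum>v\<in>A. loss M (N v) d v s) = (\<Sum>v\<in>A. 54 * d v * (\<Sum>s<M*M. ?L v s))"
    unfolding sum_loss by (subst sum.swap) (simp add: sum_distrib_left mult.assoc)
  have gain: "54 * (\<Sum>s<M*M. \<Sum>v\<in>A. gain M (N v) d v s) = (\<Sum>v\<in>A. 54 * d v * (\<Sum>s<M*M. \<Sum>u\<in>low v. hit M s (d v) u))"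
    unfolding gain_def low_def[symmetric] by (subst sum.swap) (simp add: sum_distrib_left mult.assoc)
  have "(\<Sum>v\<in>A. card (low v)) * (M * M) + 54 * (\<Sum>s<M*M. \<Sum>v\<in>A. loss M (N v) d v s)
     = (\<Sum>v\<in>A. card (low v) * (M * M) + 54 * d v * (\<Sum>s<M*M. ?L v s))"
    unfolding loss by (simp only: sum.distrib sum_distrib_right)
  also have "\<dots> \<le> 54 * (\<Sum>s<M*M. \<Sum>v\<in>A. gain M (N v) d v s)"
    unfolding gain by (intro sum_mono vertex_expectation[of _ K] M K)
  finally have "2 * (\<Sum>v\<in>A. card (low v)) * (M * M) + 108 * (\<Sum>s<M*M. \<Sum>v\<in>A. loss M (N v) d v s)
     \<le> 108 * (\<Sum>s<M*M. \<Sum>v\<in>A. gain M (N v) d v s)" by linarith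
  moreover have "(\<Sum>v\<in>A. d v) * (M * M) \<le> 2 * (\<Sum>v\<in>A. card (low v)) * (M * M)"
    using sum_d_le_low by (intro mult_right_mono) auto
  ultimately show ?thesis by linarith
qed

text \<open>Degrees do not grow on a smaller vertex set, and the removed vertices, disjoint from
  \<open>A'\<close>, take their whole degree out of the sum.\<close>

lemma edges_decrease:
  assumes "A' \<subseteq> A - removed h"
  shows "(\<Sum>v\<in>A'. card {u \<in> A'. E v u}) + (\<Sum>v\<in>removed h. d v) \<le> (\<Sum>v\<in>A. d v)"
proof -
  have R: "removed h \<subseteq> A" unfolding removed_def by auto
  have fA': "finite A'" using assms finite_A finite_subset by blast
  have fR: "finite (removed h)" using R finite_A finite_subset by blast
  have "(\<Sum>v\<in>A'. card {u \<in> A'. E v u}) \<le> (\<Sum>v\<in>A'. d v)"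
    unfolding d_def using assms by (intro sum_mono card_mono) (auto simp: N_def finite_A)
  also have "\<dots> + (\<Sum>v\<in>removed h. d v) = (\<Sum>v\<in>A' \<union> removed h. d v)"
    using assms fA' fR by (intro sum.union_disjoint[symmetric]) auto
  also have "\<dots> \<le> (\<Sum>v\<in>A. d v)"
    using assms R finite_A by (intro sum_mono2) auto
  finally show ?thesis by simp
qed

end

subsection \<open>The algorithm\<close>

fun code_nat :: "nat \<Rightarrow> bool list" where
  "code_nat n = (if n = 0 then [False] else True # odd n # code_nat (n div 2))"

declare code_nat.simps [simp del]

text \<open>A flag before every binary digit announces whether the code continues, so its end can be
  read off the string. This costs two bits per digit and makes concatenations of a known number of
  fields decodable.\<close>

lemma code_nat_prefix_free: "code_nat m @ xs = code_nat n @ ys \<Longrightarrow> m = n \<and> xs = ys"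
proof (induction m arbitrary: n rule: less_induct)
  case (less m)
  show ?case
  proof (cases "m = 0 \<or> n = 0")
    case True
    then show ?thesis using less.prems
      by (auto simp: code_nat.simps[of m] code_nat.simps[of n] split: if_splits)
  next
    case False
    then have eq: "odd m = odd n" "code_nat (m div 2) @ xs = code_nat (n div 2) @ ys"
      using less.prems by (auto simp: code_nat.simps[of m] code_nat.simps[of n])
    have "m div 2 = n div 2 \<and> xs = ys" using less.IH[OF _ eq(2)] False by auto
    moreover have "m = n" if "m div 2 = n div 2" using eq(1) that
      by (metis dvd_mult_div_cancel odd_two_times_div_two_succ)
    ultimately show ?thesis by blast
  qed
qed

lemma length_code_nat: "n < 2 ^ b \<Longrightarrow> length (code_nat n) \<le> 2 * b + 1"
proof (induction b arbitrary: n)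
  case 0
  then show ?case by (simp add: code_nat.simps)
next
  case (Suc b)
  then have "n div 2 < 2 ^ b" by auto
  then show ?case using Suc.IH by (auto simp: code_nat.simps[of n])
qed

lemma code_list_inj:
  "concat (map code_nat ms) = concat (map code_nat ns) \<Longrightarrow> length ms = length ns \<Longrightarrow> ms = ns"
proof (induction ms arbitrary: ns)
  case (Cons m ms)
  then obtain n ns' where "ns = n # ns'" by (metis length_Suc_conv)
  then show ?case using Cons code_nat_prefix_free[of m _ n] by force
qed simp

lemma length_code_list:
  "\<forall>n\<in>set ns. n < 2 ^ b \<Longrightarrow> length (concat (map code_nat ns)) \<le> length ns * (2 * b + 1)"
proof (induction ns)
  case (Cons n ns)
  then show ?case using length_code_nat[of n b] by simp
qed simp

text \<open>The arguments count remaining rounds. The round with argument 0 closes the stage and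
  moves on to the next one.\<close>

datatype stage = Elect nat | Flood nat | Spread nat | Join | Leave | Degree | Load | Gather nat

text \<open>Only the record \<open>pub\<close> is sent to the neighbours; the control record \<open>ctl\<close> stays at the node.
  The status is 0 (undecided), 1 (in the set) or 2 (excluded); \<open>cast\<close> is 0 before the broadcast
  arrives and \<open>b + 1\<close> once the bit \<open>b\<close> is known.\<close>

record ctl =
  stage :: stage
  height :: nat
  prefix :: nat
  todo :: nat

record pub =
  lead :: nat
  flag :: nat
  status :: nat
  deg :: nat
  parent :: nat
  cast :: nat
  tally0 :: nat
  tally1 :: nat

definition encode :: "pub \<Rightarrow> msg" where
  "encode q = concat (map code_nat
     [lead q, flag q, status q, deg q, parent q, cast q, tally0 q, tally1 q])"

lemma inj_encode: "inj encode"
proof (rule injI)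
  fix p q assume "encode p = encode q"
  then have "[lead p, flag p, status p, deg p, parent p, cast p, tally0 p, tally1 p]
    = [lead q, flag q, status q, deg q, parent q, cast q, tally0 q, tally1 q]"
    unfolding encode_def by (rule code_list_inj) simp
  then show "p = q" by simp
qed

section \<open>Parameters and blocks of seeds\<close>

definition id_bits :: "nat \<Rightarrow> nat" where "id_bits r = floor_log r + 1"
text \<open>With degree and identifier bound both at most \<open>2 ^ id_bits r\<close>, the factor
  \<open>2 ^ 4\<close> covers the 9 in the thresholds. A power of two makes the seeds exactly the
  bit strings of length \<open>seed_bits r\<close>.\<close>

definition modulus :: "nat \<Rightarrow> nat" where "modulus r = 2 ^ (4 + 2 * id_bits r)"
definition seed_bits :: "nat \<Rightarrow> nat" where "seed_bits r = 2 * (4 + 2 * id_bits r)"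
text \<open>Leaves room for a sum over \<open>2 ^ seed_bits r\<close> seeds of terms at most
  \<open>3 * 2 ^ (4 * id_bits r)\<close>.\<close>

definition cap :: "nat \<Rightarrow> nat" where "cap r = 2 ^ (10 * id_bits r + 10)"

text \<open>The seeds whose leading bits form \<open>p\<close> while the last \<open>j\<close> bits
  are free.\<close>

definition block :: "nat \<Rightarrow> nat \<Rightarrow> nat set" where
  "block j p = {p * 2 ^ j..<(p + 1) * 2 ^ j}"

lemma block_0: "block 0 p = {p}"
  by (auto simp: block_def)

lemma sum_block_Suc:
  "(\<Sum>s\<in>block (Suc j) p. f s) = (\<Sum>s\<in>block j (2 * p). f s) + (\<Sum>s\<in>block j (2 * p + 1). f s)"
proof -
  have "(\<Sum>s\<in>{2 * p * 2 ^ j..<(2 * p + 1) * 2 ^ j}. f s) + (\<Sum>s\<in>{(2 * p + 1) * 2 ^ j..<(2 * p + 2) * 2 ^ j}. f s)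
      = (\<Sum>s\<in>{2 * p * 2 ^ j..<(2 * p + 2) * 2 ^ j}. f s)"
    by (intro sum.atLeastLessThan_concat mult_right_mono) auto
  then show ?thesis by (simp add: block_def algebra_simps)
qed

lemma block_seeds: "block (seed_bits r) 0 = {..<modulus r * modulus r}"
proof -
  have "modulus r * modulus r = 2 ^ seed_bits r"
    unfolding modulus_def seed_bits_def by (simp only: power_add[symmetric] mult_2)
  then show ?thesis by (auto simp: block_def)
qed

lemma card_block: "card (block j p) = 2 ^ j"
  by (simp add: block_def algebra_simps)

text \<open>Here \<open>p\<close> and \<open>p'\<close> are the two candidate prefixes. Comparing
  gain minus loss of the two blocks is the same as comparing the gain of each plus the loss of the
  other, which keeps all transmitted sums natural numbers.\<close>

definition weight :: "nat \<Rightarrow> nat \<Rightarrow> nat \<Rightarrow> nat set \<Rightarrow> (nat \<Rightarrow> nat) \<Rightarrow> nat \<Rightarrow> nat \<Rightarrow> nat \<Rightarrow> nat" where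
  "weight r j v N d act p p' = (if act = 0 then
     (\<Sum>s\<in>block j p. gain (modulus r) N d v s) + (\<Sum>s\<in>block j p'. loss (modulus r) N d v s) else 0)"

definition local_weight :: "nat \<Rightarrow> nat set \<Rightarrow> ctl \<Rightarrow> (nat \<Rightarrow> pub) \<Rightarrow> nat \<Rightarrow> nat \<Rightarrow> nat" where
  "local_weight v A c g p p' = weight (lead (g v)) (todo c - 1) v {u \<in> A. status (g u) = 0}
      (\<lambda>u. deg (g u)) (status (g v)) p p'"

text \<open>The first broadcast, entered from \<open>Flood 0\<close>, only serves to build the BFS tree. It ends in \<open>Join\<close>
  with seed 0, which is harmless since joining preserves independence for every seed. The tallies
  are capped so that messages are short in every configuration; the sums that matter
  do not exceed the cap.\<close>
fun node_step :: "nat \<Rightarrow> nat set \<Rightarrow> ctl \<Rightarrow> (nat \<Rightarrow> pub) \<Rightarrow> ctl \<times> pub" where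
  "node_step v A c g = (case stage c of
     Elect 0 \<Rightarrow> (c\<lparr>stage := Flood (2 * height c)\<rparr>,
       (g v)\<lparr>flag := of_bool (\<exists>u\<in>A. lead (g u) \<noteq> lead (g v))\<rparr>)
   | Elect (Suc k) \<Rightarrow> (c\<lparr>stage := Elect k\<rparr>,
       (g v)\<lparr>lead := Max ((\<lambda>u. lead (g u)) ` insert v A)\<rparr>)
   | Flood 0 \<Rightarrow>
       (if flag (g v) = 1
        then (c\<lparr>stage := Elect (2 * height c), height := 2 * height c\<rparr>, (g v)\<lparr>lead := v\<rparr>)
        else (c\<lparr>stage := Spread (height c), todo := 1, prefix := 0\<rparr>,
              (g v)\<lparr>parent := v, cast := of_bool (v = lead (g v))\<rparr>))
   | Flood (Suc k) \<Rightarrow> (c\<lparr>stage := Flood k\<rparr>,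
       (g v)\<lparr>flag := of_bool (\<exists>u\<in>insert v A. flag (g u) = 1)\<rparr>)
   | Spread 0 \<Rightarrow> (c\<lparr>stage := (if todo c \<le> 1 then Join else Load),
                    prefix := 2 * prefix c + (cast (g v) - 1), todo := todo c - 1\<rparr>, g v)
   | Spread (Suc k) \<Rightarrow> (c\<lparr>stage := Spread k\<rparr>,
       (if cast (g v) = 0 \<and> (\<exists>u\<in>A. cast (g u) \<noteq> 0)
        then let u = (LEAST u. u \<in> A \<and> cast (g u) \<noteq> 0) in (g v)\<lparr>parent := u, cast := cast (g u)\<rparr>
        else g v))
   | Join \<Rightarrow> (c\<lparr>stage := Leave\<rparr>,
       (let h = affine_hash (modulus (lead (g v))) (prefix c) in
        if status (g v) = 0 \<and> (\<forall>u\<in>{u \<in> A. status (g u) = 0}. h v < h u)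
        then (g v)\<lparr>status := 1\<rparr> else g v))
   | Leave \<Rightarrow> (c\<lparr>stage := Degree\<rparr>,
       (if status (g v) = 0 \<and> (\<exists>u\<in>A. status (g u) = 1) then (g v)\<lparr>status := 2\<rparr> else g v))
   | Degree \<Rightarrow> (c\<lparr>stage := Load, prefix := 0, todo := seed_bits (lead (g v))\<rparr>,
       (g v)\<lparr>deg := card {u \<in> A. status (g u) = 0}\<rparr>)
   | Load \<Rightarrow> (c\<lparr>stage := Gather (height c)\<rparr>,
       (g v)\<lparr>tally0 := min (cap (lead (g v))) (local_weight v A c g (2 * prefix c) (2 * prefix c + 1)),
             tally1 := min (cap (lead (g v))) (local_weight v A c g (2 * prefix c + 1) (2 * prefix c))\<rparr>)
   | Gather 0 \<Rightarrow> (c\<lparr>stage := Spread (height c)\<rparr>,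
       (g v)\<lparr>parent := v,
             cast := (if v = lead (g v) then if tally1 (g v) \<le> tally0 (g v) then 1 else 2 else 0)\<rparr>)
   | Gather (Suc k) \<Rightarrow> (c\<lparr>stage := Gather k\<rparr>,
       (g v)\<lparr>tally0 := min (cap (lead (g v))) (local_weight v A c g (2 * prefix c) (2 * prefix c + 1)
                 + (\<Sum>u\<in>{u \<in> A. parent (g u) = v}. tally0 (g u))),
             tally1 := min (cap (lead (g v))) (local_weight v A c g (2 * prefix c + 1) (2 * prefix c)
                 + (\<Sum>u\<in>{u \<in> A. parent (g u) = v}. tally1 (g u)))\<rparr>))"

declare node_step.simps [simp del]

lemma local_weight_cong:
  assumes "\<And>u. u \<in> insert v A \<Longrightarrow> g u = g' u"
  shows "local_weight v A c g p p' = local_weight v A c g' p p'"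
proof -
  let ?N = "{u \<in> A. status (g' u) = 0}"
  have 1: "{u \<in> A. status (g u) = 0} = ?N" using assms by auto
  have gl: "gain M ?N (\<lambda>u. deg (g u)) v s = gain M ?N (\<lambda>u. deg (g' u)) v s" for M s
    by (rule gain_cong) (use assms in auto)
  have ll: "loss M ?N (\<lambda>u. deg (g u)) v s = loss M ?N (\<lambda>u. deg (g' u)) v s" for M s
    by (rule loss_cong) (use assms in auto)
  show ?thesis unfolding local_weight_def weight_def 1 using assms by (simp add: gl ll)
qed

text \<open>Locality: a step reads no public records other than those of the vertex and its
  neighbours, so it can be carried out from the received messages.\<close>

lemma node_step_cong:
  assumes "\<And>u. u \<in> insert v A \<Longrightarrow> g u = g' u"
  shows "node_step v A c g = node_step v A c g'"
proof -
  have v: "g v = g' v" and A: "\<And>u. u \<in> A \<Longrightarrow> g u = g' u" using assms by auto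
  have set: "{u \<in> A. P (g u)} = {u \<in> A. P (g' u)}" for P using A by auto
  have bex: "(\<exists>u\<in>A. P (g u)) = (\<exists>u\<in>A. P (g' u))" for P using A by auto
  have bex2: "(\<exists>u\<in>insert v A. P (g u)) = (\<exists>u\<in>insert v A. P (g' u))" for P using assms by auto
  have conj: "(u \<in> A \<and> P (g u)) = (u \<in> A \<and> P (g' u))" for P u using A by auto
  have img: "(\<lambda>u. f (g u)) ` insert v A = (\<lambda>u. f (g' u)) ` insert v A" for f :: "pub \<Rightarrow> nat"
    using assms by (intro image_cong) auto
  have sm: "(\<Sum>u\<in>{u \<in> A. parent (g' u) = v}. f (g u)) = (\<Sum>u\<in>{u \<in> A. parent (g' u) = v}. f (g' u))"
    for f :: "pub \<Rightarrow> nat" using A by simp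
  have lst: "\<exists>u\<in>A. cast (g' u) \<noteq> 0 \<Longrightarrow> g (LEAST u. u \<in> A \<and> cast (g' u) \<noteq> 0) = g' (LEAST u. u \<in> A \<and> cast (g' u) \<noteq> 0)"
    using A by (metis (mono_tags, lifting) LeastI)
  have lw: "local_weight v A c g p p' = local_weight v A c g' p p'" for p p'
    by (rule local_weight_cong) (rule assms)
  show ?thesis
    unfolding node_step.simps
    \<comment> \<open>The second split separates zero from successor for the round counter of those
      stages that carry one.\<close>
    by (cases "stage c"; (cases "case stage c of Elect k \<Rightarrow> k | Flood k \<Rightarrow> k | Spread k \<Rightarrow> k | Gather k \<Rightarrow> k | _ \<Rightarrow> 0")?)
      (simp_all add: v bex[of "\<lambda>q. lead q \<noteq> lead (g' v)"] img bex2[of "\<lambda>q. flag q = 1"]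
        bex[of "\<lambda>q. cast q \<noteq> 0", simplified] conj[of _ "\<lambda>q. cast q \<noteq> 0", simplified] set[of "\<lambda>q. status q = 0"] bex[of "\<lambda>q. status q = 1"]
        set[of "\<lambda>q. parent q = v"] sm lw lst[simplified] Let_def A)
qed

section \<open>Execution in the message-passing model\<close>

definition init_state :: "nat \<Rightarrow> ctl \<times> pub" where
  "init_state v =
     (\<lparr>stage = Elect 1, height = 1, prefix = 0, todo = 0\<rparr>,
      \<lparr>lead = v, flag = 0, status = 0, deg = 0, parent = v, cast = 0, tally0 = 0, tally1 = 0\<rparr>)"

text \<open>Away from \<open>v\<close> and its neighbours the decoded record is arbitrary; by
  \<open>node_step_cong\<close> it is never read.\<close>

definition view :: "nat \<Rightarrow> pub \<Rightarrow> inbox \<Rightarrow> nat \<Rightarrow> pub" where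
  "view v q ib u = (if u = v then q else inv encode (the (ib u)))"

definition node_state :: "nat \<Rightarrow> nat set \<Rightarrow> inbox list \<Rightarrow> ctl \<times> pub" where
  "node_state v A h = foldl (\<lambda>x ib. node_step v A (fst x) (view v (snd x) ib)) (init_state v) h"

definition mis_send :: send_fn where
  "mis_send v A h u = Some (encode (snd (node_state v A h)))"

definition mis_out :: out_fn where
  "mis_out v A h = (let a = status (snd (node_state v A h)) in if a = 0 then None else Some (a = 1))"

definition net_step :: "(nat \<Rightarrow> nat \<Rightarrow> bool) \<Rightarrow> (nat \<Rightarrow> ctl \<times> pub) \<Rightarrow> nat \<Rightarrow> ctl \<times> pub" where
  "net_step E C v = node_step v (nbrs E v) (fst (C v)) (\<lambda>u. snd (C u))"

text \<open>Reduces the model of message histories to iterating one global map. Injectivity of the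
  encoding lets every vertex recover the true records of its neighbours.\<close>

lemma node_state_hist:
  "node_state v (nbrs E v) (hist mis_send E t v) = (net_step E ^^ t) init_state v"
proof (induction t arbitrary: v)
  case 0
  then show ?case by (simp add: node_state_def)
next
  case (Suc t)
  let ?C = "(net_step E ^^ t) init_state"
  let ?ib = "\<lambda>u. if E v u then mis_send u (nbrs E u) (hist mis_send E t u) v else None"
  have "node_state v (nbrs E v) (hist mis_send E (Suc t) v)
      = node_step v (nbrs E v) (fst (?C v)) (view v (snd (?C v)) ?ib)"
    using Suc.IH[of v] by (simp add: node_state_def)
  also have "\<dots> = node_step v (nbrs E v) (fst (?C v)) (\<lambda>u. snd (?C u))"
  proof (rule node_step_cong)
    fix u assume "u \<in> insert v (nbrs E v)"
    then show "view v (snd (?C v)) ?ib u = snd (?C u)"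
      using inj_encode by (auto simp: view_def mis_send_def[of u] Suc.IH[of u]) (auto simp: nbrs_def)
  qed
  finally show ?case by (simp add: net_step_def[of E ?C])
qed

text \<open>Only the stages \<open>Join\<close> and \<open>Leave\<close> write the status, and both
  test that it is still 0.\<close>

lemma status_mono: "status (snd (C v)) \<noteq> 0 \<Longrightarrow> status (snd (net_step E C v)) = status (snd (C v))"
  unfolding net_step_def node_step.simps
  by (auto simp: Let_def split: stage.split nat.split)

lemma status_mono_pow:
  "status (snd (C v)) \<noteq> 0 \<Longrightarrow> status (snd ((net_step E ^^ k) C v)) = status (snd (C v))"
  by (induction k) (auto simp: status_mono)

section \<open>Message length\<close>

definition pub_bounded :: "nat set \<Rightarrow> pub \<Rightarrow> bool" where
  "pub_bounded V q \<longleftrightarrow> lead q \<in> V \<and> flag q \<le> 1 \<and> status q \<le> 2 \<and> deg q \<le> card V \<and> parent q \<in> V \<and>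
     cast q \<le> 2 \<and> tally0 q \<le> cap (Max V) \<and> tally1 q \<le> cap (Max V)"

lemma cap_mono: "r \<le> r' \<Longrightarrow> cap r \<le> cap r'"
  unfolding cap_def id_bits_def by (intro power_increasing) (auto simp: floor_log_le_iff)

text \<open>The bound is required in every round, so the invariant assumes nothing about the control
  records. Capping is what makes this possible for the tallies: the cap a vertex uses belongs to an
  identifier in \<open>V\<close> and is therefore at most that of \<open>Max V\<close>.\<close>

lemma net_step_bounded:
  assumes G: "simple_graph V E" and C: "\<forall>v\<in>V. pub_bounded V (snd (C v))" and v: "v \<in> V"
  shows "pub_bounded V (snd (net_step E C v))"
proof -
  have fV: "finite V" and nV: "nbrs E u \<subseteq> V" for u using G by (auto simp: simple_graph_def nbrs_def)
  have Cv: "pub_bounded V (snd (C v))" using C v by blast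
  have fn: "finite (nbrs E v)" using nV fV finite_subset by blast
  have lead: "Max ((\<lambda>u. lead (snd (C u))) ` insert v (nbrs E v)) \<in> V"
  proof -
    have "Max ((\<lambda>u. lead (snd (C u))) ` insert v (nbrs E v)) \<in> (\<lambda>u. lead (snd (C u))) ` insert v (nbrs E v)"
      using fn by (intro Max_in) auto
    moreover have "(\<lambda>u. lead (snd (C u))) ` insert v (nbrs E v) \<subseteq> V"
      using C v nV by (auto simp: pub_bounded_def)
    ultimately show ?thesis by blast
  qed
  have dg: "card {u \<in> nbrs E v. status (snd (C u)) = 0} \<le> card V"
    using nV fV by (intro card_mono) auto
  have cp: "cap (lead (snd (C v))) \<le> cap (Max V)"
    using Cv fV by (intro cap_mono) (auto simp: pub_bounded_def)
  have pr: "(LEAST u. u \<in> nbrs E v \<and> cast (snd (C u)) \<noteq> 0) \<in> V \<and>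
      cast (snd (C (LEAST u. u \<in> nbrs E v \<and> cast (snd (C u)) \<noteq> 0))) \<le> 2"
    if "\<exists>u\<in>nbrs E v. cast (snd (C u)) \<noteq> 0"
  proof -
    have "(LEAST u. u \<in> nbrs E v \<and> cast (snd (C u)) \<noteq> 0) \<in> nbrs E v"
      using that by (metis (mono_tags, lifting) LeastI)
    then show ?thesis using nV C by (auto simp: pub_bounded_def)
  qed
  show ?thesis
    using Cv v unfolding net_step_def node_step.simps pub_bounded_def Let_def
    by (cases "stage (fst (C v))"; (cases "case stage (fst (C v)) of Elect k \<Rightarrow> k | Flood k \<Rightarrow> k | Spread k \<Rightarrow> k | Gather k \<Rightarrow> k | _ \<Rightarrow> 0")?)
      (simp_all add: lead[simplified] dg cp pr[simplified] min.coboundedI1)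
qed

lemma net_run_bounded:
  assumes "simple_graph V E"
  shows "\<forall>v\<in>V. pub_bounded V (snd ((net_step E ^^ t) init_state v))"
proof (induction t)
  case 0
  then show ?case by (simp add: pub_bounded_def init_state_def)
next
  case (Suc t)
  then show ?case using net_step_bounded[OF assms Suc.IH] by simp
qed

lemma less_id_bits: "r < 2 ^ id_bits r"
  using floor_log_exp2_gt[of r] by (simp add: id_bits_def)

lemma card_le_id_bits:
  assumes "finite V"
  shows "card V \<le> 2 ^ id_bits (Max V)"
proof -
  have "V \<subseteq> {..<2 ^ id_bits (Max V)}"
    using assms less_id_bits[of "Max V"] by (meson Max_ge le_less_trans lessThan_iff subsetI)
  then show ?thesis using card_mono[of "{..<2 ^ id_bits (Max V)}" V] by simp
qed

lemma id_bits_le: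
  assumes "r < 2 ^ (c * (L + 1))"
  shows "id_bits r \<le> (c + 1) * (L + 1)"
proof -
  have "floor_log r \<le> floor_log (2 ^ (c * (L + 1)))" using assms by (intro floor_log_le_iff) auto
  then show ?thesis by (simp add: id_bits_def)
qed

lemma mis_msg_bounded:
  assumes G: "simple_graph V E" and ids: "\<forall>v\<in>V. v < 2 ^ (c * (floor_log (card V) + 1))"
  shows "msg_bounded mis_send E ((16 * (10 * (c + 1) + 11) + 8) * (floor_log (card V) + 1))"
  unfolding msg_bounded_def
proof (intro allI impI)
  fix t u v m assume uv: "E u v" and m: "mis_send u (nbrs E u) (hist mis_send E t u) v = Some m"
  let ?L = "floor_log (card V) + 1"
  define q where "q = snd ((net_step E ^^ t) init_state u)"
  \<comment> \<open>One more than the exponent in \<open>cap\<close>, so that every field is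
    strictly below \<open>2 ^ b\<close>; eight fields then cost at most \<open>16 * b + 8\<close>
    bits.\<close>
  define b where "b = 10 * id_bits (Max V) + 11"
  have V: "finite V" "V \<noteq> {}" "u \<in> V" using G uv by (auto simp: simple_graph_def)
  have ok: "pub_bounded V q" unfolding q_def using net_run_bounded[OF G] V by blast
  have "id_bits (Max V) \<le> (c + 1) * ?L" using ids V by (intro id_bits_le) auto
  then have b: "b \<le> (10 * (c + 1) + 11) * ?L" unfolding b_def by (simp add: algebra_simps)
  have p: "2 ^ id_bits (Max V) < (2::nat) ^ b" "cap (Max V) < 2 ^ b" "(2::nat) ^ 2 \<le> 2 ^ b"
    unfolding b_def cap_def by (rule power_strict_increasing power_increasing; simp)+
  have mem: "x < 2 ^ b" if "x \<in> V" for x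
    using that V less_id_bits[of "Max V"] p(1) by (meson Max_ge le_less_trans less_trans)
  have dg: "card V < 2 ^ b" using p(1) card_le_id_bits[OF V(1)] by (rule le_less_trans[rotated])
  have "\<forall>n\<in>set [lead q, flag q, status q, deg q, parent q, cast q, tally0 q, tally1 q]. n < 2 ^ b"
    using ok p mem dg unfolding pub_bounded_def by auto
  then have "length (encode q) \<le> 8 * (2 * b + 1)"
    unfolding encode_def using length_code_list by fastforce
  also have "\<dots> \<le> (16 * (10 * (c + 1) + 11) + 8) * ?L"
    using b by (simp add: algebra_simps)
  finally show "length m \<le> (16 * (10 * (c + 1) + 11) + 8) * ?L"
    using m unfolding mis_send_def node_state_hist q_def by simp
qed

text \<open>A decided status is final, so an output at any time, before or after \<open>T\<close>,
  agrees with the one at \<open>T\<close>.\<close>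

lemma mis_correct_if_decided:
  assumes mis: "maximal_independent_set V E {v \<in> V. status (snd ((net_step E ^^ T) init_state v)) = 1}"
    and dec: "\<forall>v\<in>V. status (snd ((net_step E ^^ T) init_state v)) \<noteq> 0"
  shows "computes_MIS_within mis_send mis_out V E T"
proof -
  let ?st = "\<lambda>t v. status (snd ((net_step E ^^ t) init_state v))"
  let ?I = "{v \<in> V. ?st T v = 1}"
  have later: "?st t v \<noteq> 0 \<Longrightarrow> t \<le> t' \<Longrightarrow> ?st t' v = ?st t v" for t t' v
    using status_mono_pow[where C = "(net_step E ^^ t) init_state" and E = E and k = "t' - t" and v = v]
      funpow_add[of "t' - t" t "net_step E"] by simp
  have out: "output_at mis_send mis_out E t v = (if ?st t v = 0 then None else Some (?st t v = 1))" for t v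
    by (simp add: output_at_def mis_out_def node_state_hist Let_def)
  have "\<forall>v\<in>V. \<forall>t b. output_at mis_send mis_out E t v = Some b \<longrightarrow> b = (v \<in> ?I)"
  proof (intro ballI allI impI)
    fix v t b assume v: "v \<in> V" and b: "output_at mis_send mis_out E t v = Some b"
    then have nz: "?st t v \<noteq> 0" by (auto simp: out split: if_splits)
    have "?st t v = ?st T v"
      using later[of t v T] later[of T v t] nz dec v by (cases "t \<le> T") auto
    then show "b = (v \<in> ?I)" using b nz v by (simp add: out)
  qed
  moreover have "\<forall>v\<in>V. output_at mis_send mis_out E T v = Some (v \<in> ?I)" using dec by (simp add: out)
  ultimately show ?thesis unfolding computes_MIS_within_def using mis by blast
qed

subsection \<open>Leader election\<close>

text \<open>The ball of radius \<open>k\<close>, defined through its first hop: this is the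
  recursion that a round of flooding carries out.\<close>

fun hop_ball :: "(nat \<Rightarrow> nat \<Rightarrow> bool) \<Rightarrow> nat \<Rightarrow> nat \<Rightarrow> nat set" where
  "hop_ball E 0 v = {v}"
| "hop_ball E (Suc k) v = (\<Union>u\<in>insert v (nbrs E v). hop_ball E k u)"

lemma hop_ball_trans: "u \<in> hop_ball E j v \<Longrightarrow> w \<in> hop_ball E k u \<Longrightarrow> w \<in> hop_ball E (j + k) v"
  by (induction j arbitrary: v) auto

lemma center_in_hop_ball [simp]: "v \<in> hop_ball E k v"
  by (induction k) auto

lemma hop_ball_mono: "j \<le> k \<Longrightarrow> u \<in> hop_ball E j v \<Longrightarrow> u \<in> hop_ball E k v"
  using hop_ball_trans[of u E j v u "k - j"] by simp

lemma reach_in_hop_ball: "reach_in E k u v \<Longrightarrow> v \<in> hop_ball E k u"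
proof (induction k arbitrary: u)
  case 0
  then obtain xs where "hd xs = u" "last xs = v" "length xs = Suc 0" by (auto simp: reach_in_def)
  then show ?case by (cases xs) auto
next
  case (Suc k)
  then obtain xs where xs: "walk E xs" "hd xs = u" "last xs = v" "length xs = Suc (Suc k)"
    by (auto simp: reach_in_def)
  then obtain y ys where ys: "xs = u # y # ys" by (metis length_Suc_conv list.sel(1))
  have "E u y" using xs(1) ys unfolding walk_def by force
  moreover have "walk E (y # ys)" using xs(1) ys unfolding walk_def by force
  then have "reach_in E k y v" unfolding reach_in_def using xs ys by (intro exI[of _ "y # ys"]) auto
  ultimately show ?case using Suc.IH by (auto simp: nbrs_def)
qed

text \<open>By \<open>2 * 107 ^ 108 \<le> 108 ^ 108\<close>, shrinking 108 times by the factor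
  107/108 at least halves a number, and \<open>j\<close> halvings bring a natural number below
  \<open>2 ^ j\<close> to zero.\<close>

lemma edges_vanish:
  assumes "108 ^ (108 * j) * e' \<le> 107 ^ (108 * j) * e" "e < (2::nat) ^ j"
  shows "e' = (0::nat)"
proof (rule ccontr)
  assume "e' \<noteq> 0"
  have "2 * 107 ^ 108 \<le> (108 ^ 108 :: nat)" by simp
  then have "(2 * 107 ^ 108) ^ j \<le> ((108 ^ 108) ^ j :: nat)" by (rule power_mono) simp
  then have "2 ^ j * 107 ^ (108 * j) \<le> (108 ^ (108 * j) :: nat)" by (simp only: power_mult power_mult_distrib)
  also have "\<dots> \<le> 108 ^ (108 * j) * e'" using \<open>e' \<noteq> 0\<close> by (cases e') auto
  also have "\<dots> \<le> 107 ^ (108 * j) * e" by (rule assms(1))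
  also have "\<dots> = e * 107 ^ (108 * j)" by (rule mult.commute)
  finally have "2 ^ j \<le> e" by (rule mult_right_le_imp_le) simp
  then show False using assms(2) by simp
qed

locale network =
  fixes V :: "nat set" and E :: "nat \<Rightarrow> nat \<Rightarrow> bool"
  assumes graph: "simple_graph V E" and conn: "connected_graph V E"
begin

lemma finite_V: "finite V" and V_ne: "V \<noteq> {}" and E_V: "E u v \<Longrightarrow> u \<in> V \<and> v \<in> V"
  and E_sym: "E u v \<Longrightarrow> E v u" and E_irrefl: "\<not> E u u"
  using graph by (auto simp: simple_graph_def)

lemma nbrs_V: "nbrs E v \<subseteq> V" using E_V by (auto simp: nbrs_def)
lemma finite_nbrs [simp]: "finite (nbrs E v)" using nbrs_V finite_V finite_subset by blast

lemma hop_ball_V: "v \<in> V \<Longrightarrow> hop_ball E k v \<subseteq> V"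
proof (induction k arbitrary: v)
  case (Suc k)
  then show ?case using nbrs_V by fastforce
qed simp

lemma hop_ball_sym: "u \<in> hop_ball E k v \<Longrightarrow> v \<in> hop_ball E k u"
proof (induction k arbitrary: v)
  case (Suc k)
  then obtain w where w: "w = v \<or> E v w" "u \<in> hop_ball E k w" by (auto simp: nbrs_def)
  have "v \<in> hop_ball E (Suc 0) w" using w(1) E_sym by (auto simp: nbrs_def)
  then show ?case using hop_ball_trans[OF Suc.IH[OF w(2)], of v "Suc 0"] by simp
qed simp

lemma hop_ball_outer: "u \<in> hop_ball E (Suc k) v \<Longrightarrow> \<exists>w. (u = w \<or> E w u) \<and> w \<in> hop_ball E k v"
  using hop_ball_sym[of u "Suc k" v] hop_ball_sym E_sym by (auto simp: nbrs_def) blast+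

lemma hop_ball_diameter:
  assumes "u \<in> V" "v \<in> V"
  shows "v \<in> hop_ball E (diameter V E) u"
proof -
  have "\<exists>k. reach_in E k u v" using conn assms by (simp add: connected_graph_def)
  then have "reach_in E (gdist E u v) u v" unfolding gdist_def by (rule LeastI_ex)
  then have b: "v \<in> hop_ball E (gdist E u v) u" by (rule reach_in_hop_ball)
  have "{gdist E u v | u v. u \<in> V \<and> v \<in> V} = (\<lambda>(u, v). gdist E u v) ` (V \<times> V)" by auto
  then have "finite {gdist E u v | u v. u \<in> V \<and> v \<in> V}" using finite_V by simp
  then have "gdist E u v \<le> diameter V E" unfolding diameter_def using assms by (intro Max_ge) auto
  then show ?thesis using b hop_ball_mono by blast
qed

lemma propagate:
  assumes "v \<in> V" "w \<in> V" "P v" and "\<And>x y. x \<in> V \<Longrightarrow> P x \<Longrightarrow> E x y \<Longrightarrow> P y"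
  shows "P w"
proof -
  have "u \<in> hop_ball E k v \<Longrightarrow> P u" for u k
  proof (induction k arbitrary: u)
    case 0
    then show ?case using assms(3) by simp
  next
    case (Suc k)
    then show ?case using hop_ball_outer[of u k v] assms(4) E_V by blast
  qed
  then show ?thesis using hop_ball_diameter[OF assms(1,2)] by blast
qed

section \<open>Regional maxima and their conflicts\<close>

definition reg_max :: "nat \<Rightarrow> nat \<Rightarrow> nat" where "reg_max k v = Max (hop_ball E k v)"

lemma finite_hop_ball [simp]: "finite (hop_ball E k v)"
  by (induction k arbitrary: v) auto

lemma reg_max_in: "reg_max k v \<in> hop_ball E k v"
  unfolding reg_max_def using center_in_hop_ball[of v E k] by (intro Max_in finite_hop_ball) blast

lemma reg_max_Suc: "reg_max (Suc k) v = Max (reg_max k ` insert v (nbrs E v))"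
proof (rule Max_eqI[symmetric])
  show "finite (reg_max k ` insert v (nbrs E v))" by simp
  show "y \<le> reg_max (Suc k) v" if y: "y \<in> reg_max k ` insert v (nbrs E v)" for y
  proof -
    obtain u where u: "u \<in> insert v (nbrs E v)" "y = reg_max k u" using y by blast
    then have "y \<in> hop_ball E (Suc k) v" using reg_max_in[of k u] by auto
    then show ?thesis unfolding reg_max_def[of "Suc k"] by (intro Max_ge finite_hop_ball)
  qed
  obtain u where u: "u \<in> insert v (nbrs E v)" "reg_max (Suc k) v \<in> hop_ball E k u"
    using reg_max_in[of "Suc k" v] by auto
  have "reg_max k u \<in> hop_ball E (Suc k) v" using u reg_max_in[of k u] by auto
  then have "reg_max k u \<le> reg_max (Suc k) v" unfolding reg_max_def[of "Suc k"] by (intro Max_ge finite_hop_ball)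
  moreover have "reg_max (Suc k) v \<le> reg_max k u" unfolding reg_max_def[of k] using u by (intro Max_ge) auto
  ultimately show "reg_max (Suc k) v \<in> reg_max k ` insert v (nbrs E v)" using u by (metis antisym imageI)
qed

definition conflict :: "nat \<Rightarrow> nat \<Rightarrow> bool" where
  "conflict H v \<longleftrightarrow> (\<exists>u\<in>nbrs E v. reg_max H u \<noteq> reg_max H v)"

text \<open>The vertices that agree with \<open>v\<close> lie within distance \<open>H\<close> of their common maximum,
  hence within distance \<open>2 * H\<close> of \<open>v\<close>.\<close>
lemma no_conflict_imp_agree:
  assumes v: "v \<in> V" "w \<in> V" and nc: "\<And>x. x \<in> hop_ball E (2 * H) v \<Longrightarrow> \<not> conflict H x"
  shows "reg_max H w = reg_max H v"
proof (rule propagate[OF v, where P = "\<lambda>x. reg_max H x = reg_max H v"])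
  fix x y assume x: "x \<in> V" "reg_max H x = reg_max H v" "E x y"
  have "x \<in> hop_ball E H (reg_max H v)" using reg_max_in[of H x] x(2) hop_ball_sym by metis
  then have "x \<in> hop_ball E (2 * H) v" using hop_ball_trans[OF reg_max_in] by (simp add: mult_2)
  then show "reg_max H y = reg_max H v" using nc[of x] x by (auto simp: conflict_def nbrs_def)
qed simp

text \<open>If \<open>w\<close> saw no conflict, all vertices would share its maximum and there
  would be no conflict anywhere. Hence all vertices take the same decision about the next
  epoch.\<close>

lemma conflict_all_or_none:
  assumes "v \<in> V" "w \<in> V" "\<exists>x\<in>hop_ball E (2 * H) v. conflict H x"
  shows "\<exists>x\<in>hop_ball E (2 * H) w. conflict H x"
proof (rule ccontr)
  assume "\<not> ?thesis"
  then have *: "\<And>x. x \<in> V \<Longrightarrow> reg_max H x = reg_max H w" using no_conflict_imp_agree[OF assms(2)] by blast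
  obtain x where x: "x \<in> hop_ball E (2 * H) v" "conflict H x" using assms by blast
  then obtain u where u: "u \<in> nbrs E x" "reg_max H u \<noteq> reg_max H x" by (auto simp: conflict_def)
  have "u \<in> V" "x \<in> V" using x(1) u(1) hop_ball_V[OF assms(1)] nbrs_V by auto
  then show False using *[of u] *[of x] u(2) by simp
qed

text \<open>From the diameter on every ball is all of \<open>V\<close>, so all maxima coincide. This
  limits the doubling of \<open>H\<close>.\<close>

lemma conflict_imp_less_diameter:
  assumes "v \<in> V" "conflict H v"
  shows "H < diameter V E"
proof (rule ccontr)
  assume "\<not> ?thesis"
  then have "diameter V E \<le> H" by simp
  then have "hop_ball E H u = V" if "u \<in> V" for u
    using hop_ball_V[OF that] hop_ball_diameter[OF that] hop_ball_mono by blast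
  then have "reg_max H u = Max V" if "u \<in> V" for u using that by (simp add: reg_max_def)
  moreover obtain u where "u \<in> V" "reg_max H u \<noteq> reg_max H v"
    using assms(2) nbrs_V unfolding conflict_def by blast
  ultimately show False using assms(1) by simp
qed

section \<open>Synchronised runs with a common control record\<close>

definition sync :: "(nat \<Rightarrow> ctl \<times> pub) \<Rightarrow> ctl \<Rightarrow> (nat \<Rightarrow> pub) \<Rightarrow> bool" where
  "sync C c q \<longleftrightarrow> (\<forall>v\<in>V. C v = (c, q v))"

lemma sync_step:
  assumes "sync C c q" "\<And>v. v \<in> V \<Longrightarrow> node_step v (nbrs E v) c q = (c', q' v)"
  shows "sync (net_step E C) c' q'"
  unfolding sync_def
proof
  fix v assume v: "v \<in> V"
  have "net_step E C v = node_step v (nbrs E v) c (\<lambda>u. snd (C u))"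
    using assms(1) v by (simp add: net_step_def sync_def)
  also have "\<dots> = node_step v (nbrs E v) c q"
    using assms(1) v subsetD[OF nbrs_V] by (intro node_step_cong) (auto simp: sync_def)
  finally show "net_step E C v = (c', q' v)" using assms(2)[OF v] by simp
qed

text \<open>A Hoare-style triple with an exact round count; such triples compose by
  \<open>steps_trans\<close>.\<close>

definition steps :: "nat \<Rightarrow> ctl \<Rightarrow> (nat \<Rightarrow> pub) \<Rightarrow> ctl \<Rightarrow> (nat \<Rightarrow> pub) \<Rightarrow> bool" where
  "steps k c q c' q' \<longleftrightarrow> (\<forall>C. sync C c q \<longrightarrow> sync ((net_step E ^^ k) C) c' q')"

lemma steps_0: "(\<And>v. v \<in> V \<Longrightarrow> q v = q' v) \<Longrightarrow> steps 0 c q c q'"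
  by (simp add: steps_def sync_def)

lemma steps_1: "(\<And>v. v \<in> V \<Longrightarrow> node_step v (nbrs E v) c q = (c', q' v)) \<Longrightarrow> steps (Suc 0) c q c' q'"
  unfolding steps_def using sync_step by simp

lemma steps_trans:
  assumes "steps j c q c' q'" "steps k c' q' c'' q''"
  shows "steps (j + k) c q c'' q''"
  using assms unfolding steps_def by (simp add: add.commute[of j] funpow_add)

lemma steps_Suc:
  assumes "steps k c q c' q'" "\<And>v. v \<in> V \<Longrightarrow> node_step v (nbrs E v) c' q' = (c'', q'' v)"
  shows "steps (Suc k) c q c'' q''"
  using steps_trans[OF assms(1) steps_1[OF assms(2)]] by simp

text \<open>The counter runs down while the induction appends rounds at the end, so a surplus of
  \<open>k\<close> rounds is kept general.\<close>

lemma steps_Elect: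
  assumes "\<And>v. v \<in> V \<Longrightarrow> lead (q v) = v"
  shows "steps i (c\<lparr>stage := Elect (i + k)\<rparr>) q (c\<lparr>stage := Elect k\<rparr>) (\<lambda>v. (q v)\<lparr>lead := reg_max i v\<rparr>)"
proof (induction i arbitrary: k)
  case 0
  show ?case using assms by (auto intro!: steps_0 simp: reg_max_def)
next
  case (Suc i)
  have "steps i (c\<lparr>stage := Elect (i + Suc k)\<rparr>) q (c\<lparr>stage := Elect (Suc k)\<rparr>) (\<lambda>v. (q v)\<lparr>lead := reg_max i v\<rparr>)"
    by (rule Suc.IH)
  then have "steps (Suc i) (c\<lparr>stage := Elect (i + Suc k)\<rparr>) q (c\<lparr>stage := Elect k\<rparr>) (\<lambda>v. (q v)\<lparr>lead := reg_max (Suc i) v\<rparr>)"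
    by (rule steps_Suc) (simp add: node_step.simps reg_max_Suc)
  then show ?case by simp
qed

lemma steps_Flood:
  assumes "\<And>v. v \<in> V \<Longrightarrow> flag (q v) = of_bool (P v)"
  shows "steps i (c\<lparr>stage := Flood (i + k)\<rparr>) q (c\<lparr>stage := Flood k\<rparr>)
     (\<lambda>v. (q v)\<lparr>flag := of_bool (\<exists>x\<in>hop_ball E i v. P x)\<rparr>)"
proof (induction i arbitrary: k)
  case 0
  show ?case using assms by (auto intro!: steps_0)
next
  case (Suc i)
  have "steps i (c\<lparr>stage := Flood (i + Suc k)\<rparr>) q (c\<lparr>stage := Flood (Suc k)\<rparr>)
     (\<lambda>v. (q v)\<lparr>flag := of_bool (\<exists>x\<in>hop_ball E i v. P x)\<rparr>)" by (rule Suc.IH)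
  then have "steps (Suc i) (c\<lparr>stage := Flood (i + Suc k)\<rparr>) q (c\<lparr>stage := Flood k\<rparr>)
     (\<lambda>v. (q v)\<lparr>flag := of_bool (\<exists>x\<in>hop_ball E (Suc i) v. P x)\<rparr>)"
  proof (rule steps_Suc)
    fix v
    have "(\<exists>x\<in>hop_ball E (Suc i) v. P x) = (\<exists>u\<in>insert v (nbrs E v). \<exists>x\<in>hop_ball E i u. P x)" by auto
    then show "node_step v (nbrs E v) (c\<lparr>stage := Flood (Suc k)\<rparr>)
        (\<lambda>v. (q v)\<lparr>flag := of_bool (\<exists>x\<in>hop_ball E i v. P x)\<rparr>)
      = (c\<lparr>stage := Flood k\<rparr>, (q v)\<lparr>flag := of_bool (\<exists>x\<in>hop_ball E (Suc i) v. P x)\<rparr>)"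
      by (simp add: node_step.simps del: hop_ball.simps)
  qed
  then show ?case by simp
qed

text \<open>The \<open>3 * H + 2\<close> rounds are \<open>H\<close> for the maxima, one to compare
  neighbours, \<open>2 * H\<close> to flood conflicts and one to decide. Without a conflict the
  common maximum is at least every identifier, hence it is \<open>Max V\<close>, and it lies within
  distance \<open>H\<close> of all vertices.\<close>

lemma epoch:
  assumes q: "\<And>v. v \<in> V \<Longrightarrow> lead (q v) = v" and c: "stage c = Elect (height c)"
  defines "H \<equiv> height c"
  shows "(H < diameter V E \<and> (\<exists>q'. steps (3 * H + 2) c q (c\<lparr>stage := Elect (2 * H), height := 2 * H\<rparr>) q' \<and>
            (\<forall>v\<in>V. lead (q' v) = v \<and> status (q' v) = status (q v)))) \<or>
         (\<exists>r q'. steps (3 * H + 2) c q (c\<lparr>stage := Spread H, todo := 1, prefix := 0\<rparr>) q' \<and>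
            r = Max V \<and> (\<forall>v\<in>V. r \<in> hop_ball E H v) \<and>
            (\<forall>v\<in>V. lead (q' v) = r \<and> parent (q' v) = v \<and> cast (q' v) = of_bool (v = r) \<and>
               status (q' v) = status (q v)))"
proof -
  let ?P = "conflict H" and ?F = "\<lambda>v. \<exists>x\<in>hop_ball E (2 * H) v. conflict H x"
  define q1 where "q1 = (\<lambda>v. (q v)\<lparr>lead := reg_max H v\<rparr>)"
  define q2 where "q2 = (\<lambda>v. (q1 v)\<lparr>flag := of_bool (?P v)\<rparr>)"
  define q3 where "q3 = (\<lambda>v. (q2 v)\<lparr>flag := of_bool (?F v)\<rparr>)"
  have c': "c\<lparr>stage := Elect (H + 0)\<rparr> = c" using c by (simp add: H_def)
  have "steps H (c\<lparr>stage := Elect (H + 0)\<rparr>) q (c\<lparr>stage := Elect 0\<rparr>) q1"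
    unfolding q1_def by (rule steps_Elect) (rule q)
  then have "steps H c q (c\<lparr>stage := Elect 0\<rparr>) q1" by (simp only: c')
  then have s2: "steps (Suc H) c q (c\<lparr>stage := Flood (2 * H + 0)\<rparr>) q2"
    by (rule steps_Suc) (auto simp: node_step.simps q1_def q2_def conflict_def H_def)
  have "steps (2 * H) (c\<lparr>stage := Flood (2 * H + 0)\<rparr>) q2 (c\<lparr>stage := Flood 0\<rparr>) q3"
    unfolding q3_def by (rule steps_Flood) (simp add: q2_def)
  from steps_trans[OF s2 this] have s3: "steps (3 * H + 1) c q (c\<lparr>stage := Flood 0\<rparr>) q3"
    by (simp add: algebra_simps)
  have len: "3 * H + 2 = Suc (3 * H + 1)" by simp
  obtain v0 where v0: "v0 \<in> V" using V_ne by blast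
  show ?thesis
  proof (cases "?F v0")
    case True
    then have F: "?F v" if "v \<in> V" for v using conflict_all_or_none v0 that by blast
    obtain x where "x \<in> V" "conflict H x" using True hop_ball_V[OF v0] by blast
    then have "H < diameter V E" by (rule conflict_imp_less_diameter)
    moreover have "steps (Suc (3 * H + 1)) c q (c\<lparr>stage := Elect (2 * H), height := 2 * H\<rparr>) (\<lambda>v. (q3 v)\<lparr>lead := v\<rparr>)"
      using s3 by (rule steps_Suc) (use F in \<open>simp add: node_step.simps q3_def H_def\<close>)
    moreover have "\<forall>v\<in>V. lead ((q3 v)\<lparr>lead := v\<rparr>) = v \<and> status ((q3 v)\<lparr>lead := v\<rparr>) = status (q v)"
      by (simp add: q3_def q2_def q1_def)
    ultimately show ?thesis unfolding len by blast
  next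
    case False
    then have nF: "\<not> ?F v" if "v \<in> V" for v using conflict_all_or_none v0 that by blast
    define r where "r = reg_max H v0"
    have r: "reg_max H v = r" if "v \<in> V" for v
      unfolding r_def using no_conflict_imp_agree[OF v0 that] False by blast
    have rV: "r \<in> V" unfolding r_def using reg_max_in hop_ball_V[OF v0] by blast
    have "v \<le> r" if "v \<in> V" for v
      using r[OF that] unfolding reg_max_def by (metis Max_ge center_in_hop_ball finite_hop_ball)
    then have rM: "r = Max V" using rV finite_V by (metis Max_eqI)
    have rb: "r \<in> hop_ball E H v" if "v \<in> V" for v using reg_max_in[of H v] r[OF that] by simp
    let ?q = "\<lambda>v. (q3 v)\<lparr>parent := v, cast := of_bool (v = r)\<rparr>"
    have "steps (Suc (3 * H + 1)) c q (c\<lparr>stage := Spread H, todo := 1, prefix := 0\<rparr>) ?q"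
      using s3 by (rule steps_Suc) (use nF r in \<open>simp add: node_step.simps q3_def q2_def q1_def H_def\<close>)
    moreover have "\<forall>v\<in>V. lead (?q v) = r \<and> parent (?q v) = v \<and> cast (?q v) = of_bool (v = r) \<and>
        status (?q v) = status (q v)" using r by (simp add: q3_def q2_def q1_def)
    ultimately show ?thesis unfolding len using rM rb by blast
  qed
qed

definition elected :: "nat \<Rightarrow> (nat \<Rightarrow> pub) \<Rightarrow> bool" where
  "elected H q \<longleftrightarrow> (\<forall>v\<in>V. Max V \<in> hop_ball E H v \<and> lead (q v) = Max V \<and> parent (q v) = v \<and>
     cast (q v) = of_bool (v = Max V) \<and> status (q v) = 0)"

text \<open>An epoch with height \<open>h \<ge> 1\<close> costs \<open>3 * h + 2 \<le> 5 * h\<close>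
  rounds and heights double, so the geometric sum up to \<open>H\<close> is at most
  \<open>10 * H\<close> minus five times the initial height. Doubling happens only below the
  diameter, which bounds the final height.\<close>

lemma leader_election:
  assumes "\<And>v. v \<in> V \<Longrightarrow> lead (q v) = v \<and> status (q v) = 0" "stage c = Elect (height c)" "height c > 0"
  shows "\<exists>k H q'. steps k c q \<lparr>stage = Spread H, height = H, prefix = 0, todo = 1\<rparr> q' \<and>
     k + 5 * height c \<le> 10 * H \<and> H \<le> max (height c) (2 * diameter V E) \<and> elected H q'"
  using assms
proof (induction "diameter V E - height c" arbitrary: c q rule: less_induct)
  case less
  let ?H = "height c"
  have "\<And>v. v \<in> V \<Longrightarrow> lead (q v) = v" using less.prems(1) by blast
  from epoch[of q c, OF this less.prems(2)] consider
    (fail) q' where "?H < diameter V E" "steps (3 * ?H + 2) c q (c\<lparr>stage := Elect (2 * ?H), height := 2 * ?H\<rparr>) q'"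
       "\<forall>v\<in>V. lead (q' v) = v \<and> status (q' v) = status (q v)"
  | (succ) q' where "steps (3 * ?H + 2) c q (c\<lparr>stage := Spread ?H, todo := 1, prefix := 0\<rparr>) q'"
      "\<forall>v\<in>V. Max V \<in> hop_ball E ?H v"
      "\<forall>v\<in>V. lead (q' v) = Max V \<and> parent (q' v) = v \<and> cast (q' v) = of_bool (v = Max V) \<and>
               status (q' v) = status (q v)" by blast
  then show ?case
  proof cases
    case fail
    let ?c = "c\<lparr>stage := Elect (2 * ?H), height := 2 * ?H\<rparr>"
    have m: "diameter V E - height ?c < diameter V E - height c" using fail(1) less.prems(3) by simp
    have "\<exists>k H q''. steps k ?c q' \<lparr>stage = Spread H, height = H, prefix = 0, todo = 1\<rparr> q'' \<and>
     k + 5 * height ?c \<le> 10 * H \<and> H \<le> max (height ?c) (2 * diameter V E) \<and> elected H q''"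
      by (rule less.hyps[OF m]) (use fail(3) less.prems in auto)
    then obtain k H q'' where *: "steps k ?c q' \<lparr>stage = Spread H, height = H, prefix = 0, todo = 1\<rparr> q''"
      "k + 5 * height ?c \<le> 10 * H" "H \<le> max (height ?c) (2 * diameter V E)" "elected H q''" by blast
    have "steps (3 * ?H + 2 + k) c q \<lparr>stage = Spread H, height = H, prefix = 0, todo = 1\<rparr> q''"
      by (rule steps_trans[OF fail(2) *(1)])
    moreover have "3 * ?H + 2 + k + 5 * ?H \<le> 10 * H" using *(2) less.prems(3) by simp
    moreover have "H \<le> max (height c) (2 * diameter V E)" using *(3) fail(1) by simp
    ultimately show ?thesis using *(4) by blast
  next
    case succ
    have "c\<lparr>stage := Spread ?H, todo := 1, prefix := 0\<rparr> = \<lparr>stage = Spread ?H, height = ?H, prefix = 0, todo = 1\<rparr>"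
      by simp
    then have "steps (3 * ?H + 2) c q \<lparr>stage = Spread ?H, height = ?H, prefix = 0, todo = 1\<rparr> q'"
      using succ(1) by (simp only:)
    moreover have "3 * ?H + 2 + 5 * ?H \<le> 10 * ?H" using less.prems(3) by simp
    moreover have "elected ?H q'" using succ(2,3) less.prems(1) by (simp add: elected_def)
    moreover have "?H \<le> max ?H (2 * diameter V E)" by simp
    ultimately show ?thesis by blast
  qed
qed

subsection \<open>Broadcast and summation along a BFS tree\<close>

abbreviation "leader \<equiv> Max V"

lemma leader_V: "leader \<in> V" using finite_V V_ne by simp

definition level :: "nat \<Rightarrow> nat" where "level v = (LEAST j. leader \<in> hop_ball E j v)"

definition bfs_tree :: "nat \<Rightarrow> (nat \<Rightarrow> nat) \<Rightarrow> bool" where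
  "bfs_tree H pf \<longleftrightarrow> pf leader = leader \<and>
     (\<forall>v\<in>V. level v \<le> H \<and> (v \<noteq> leader \<longrightarrow> E v (pf v) \<and> level v = Suc (level (pf v))))"

lemma level_le: "leader \<in> hop_ball E j v \<Longrightarrow> level v \<le> j"
  unfolding level_def by (rule Least_le)

lemma level_leader [simp]: "level leader = 0"
  using level_le[of 0 leader] by simp

lemma leader_in_level: "leader \<in> hop_ball E j v \<Longrightarrow> leader \<in> hop_ball E (level v) v"
  unfolding level_def by (rule LeastI)

text \<open>The level of \<open>v\<close> exceeds \<open>i\<close>, that of \<open>u\<close> does
  not, and adjacency allows a difference of at most one.\<close>

lemma level_next:
  assumes "leader \<notin> hop_ball E i v" "E v u" "leader \<in> hop_ball E i u"
  shows "level v = Suc (level u)"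
proof -
  have "leader \<in> hop_ball E (Suc (level u)) v" using leader_in_level[OF assms(3)] assms(2) by (auto simp: nbrs_def)
  then have le: "level v \<le> Suc (level u)" and "leader \<in> hop_ball E (level v) v"
    using level_le leader_in_level by blast+
  then have "\<not> level v \<le> i" using assms(1) hop_ball_mono by blast
  then show ?thesis using le level_le[OF assms(3)] by linarith
qed

text \<open>After \<open>i\<close> rounds the value has reached exactly the vertices within distance
  \<open>i\<close> of the leader. A newly reached vertex adopts a neighbour that was reached before
  it, so parents lie one level closer to the leader.\<close>

lemma steps_Spread:
  assumes b: "b \<noteq> 0"
    and q: "\<And>v. v \<in> V \<Longrightarrow> parent (q v) = v \<and> cast (q v) = (if v = leader then b else 0)"
  shows "\<exists>pf. steps i (c\<lparr>stage := Spread (i + k)\<rparr>) q (c\<lparr>stage := Spread k\<rparr>)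
      (\<lambda>v. (q v)\<lparr>parent := pf v, cast := (if leader \<in> hop_ball E i v then b else 0)\<rparr>) \<and>
    pf leader = leader \<and>
    (\<forall>v\<in>V. v \<noteq> leader \<longrightarrow> leader \<in> hop_ball E i v \<longrightarrow> E v (pf v) \<and> level v = Suc (level (pf v)))"
proof (induction i arbitrary: k)
  case 0
  have "steps 0 (c\<lparr>stage := Spread (0 + k)\<rparr>) q (c\<lparr>stage := Spread k\<rparr>)
      (\<lambda>v. (q v)\<lparr>parent := v, cast := (if leader \<in> hop_ball E 0 v then b else 0)\<rparr>)"
  proof -
    have "q v = (q v)\<lparr>parent := v, cast := (if leader \<in> hop_ball E 0 v then b else 0)\<rparr>" if "v \<in> V" for v
      using q[OF that] by (cases "q v") auto
    then have "steps 0 (c\<lparr>stage := Spread k\<rparr>) q (c\<lparr>stage := Spread k\<rparr>)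
      (\<lambda>v. (q v)\<lparr>parent := v, cast := (if leader \<in> hop_ball E 0 v then b else 0)\<rparr>)" by (rule steps_0)
    then show ?thesis by simp
  qed
  then show ?case by (intro exI[of _ "\<lambda>v. v"]) auto
next
  case (Suc i)
  let ?q = "\<lambda>pf i v. (q v)\<lparr>parent := pf v, cast := (if leader \<in> hop_ball E i v then b else 0)\<rparr>"
  obtain pf where st: "steps i (c\<lparr>stage := Spread (i + Suc k)\<rparr>) q (c\<lparr>stage := Spread (Suc k)\<rparr>) (?q pf i)"
    and pr: "pf leader = leader"
    and pf: "\<forall>v\<in>V. v \<noteq> leader \<longrightarrow> leader \<in> hop_ball E i v \<longrightarrow> E v (pf v) \<and> level v = Suc (level (pf v))"
    using Suc.IH[of "Suc k"] by blast
  \<comment> \<open>The vertices that the value reaches in precisely this round; all others keep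
    their parent.\<close>
  define new where "new v \<longleftrightarrow> leader \<notin> hop_ball E i v \<and> (\<exists>u\<in>nbrs E v. leader \<in> hop_ball E i u)" for v
  define pf' where "pf' v = (if new v then LEAST u. u \<in> nbrs E v \<and> leader \<in> hop_ball E i u else pf v)" for v
  have newL: "pf' v \<in> nbrs E v \<and> leader \<in> hop_ball E i (pf' v)" if "new v" for v
  proof -
    have "\<exists>u. u \<in> nbrs E v \<and> leader \<in> hop_ball E i u" using that by (auto simp: new_def)
    then show ?thesis using that unfolding pf'_def by simp (rule LeastI_ex)
  qed
  have "steps (Suc i) (c\<lparr>stage := Spread (i + Suc k)\<rparr>) q (c\<lparr>stage := Spread k\<rparr>) (?q pf' (Suc i))"
    using st
  proof (rule steps_Suc)
    fix v assume "v \<in> V"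
    have gen: "node_step v (nbrs E v) (c\<lparr>stage := Spread (Suc k)\<rparr>) g = (c\<lparr>stage := Spread k\<rparr>,
       if \<not> cast (g v) \<noteq> 0 \<and> (\<exists>u\<in>nbrs E v. cast (g u) \<noteq> 0)
       then let u = (LEAST u. u \<in> nbrs E v \<and> cast (g u) \<noteq> 0) in (g v)\<lparr>parent := u, cast := cast (g u)\<rparr>
       else g v)" for g by (simp add: node_step.simps)
    have cast: "(cast (?q pf i u) \<noteq> 0) = (leader \<in> hop_ball E i u)" for u using b by simp
    have out: "node_step v (nbrs E v) (c\<lparr>stage := Spread (Suc k)\<rparr>) (?q pf i) = (c\<lparr>stage := Spread k\<rparr>,
       if new v then let u = (LEAST u. u \<in> nbrs E v \<and> leader \<in> hop_ball E i u) in (?q pf i v)\<lparr>parent := u, cast := cast (?q pf i u)\<rparr>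
       else ?q pf i v)"
      unfolding gen cast new_def ..
    show "node_step v (nbrs E v) (c\<lparr>stage := Spread (Suc k)\<rparr>) (?q pf i) = (c\<lparr>stage := Spread k\<rparr>, ?q pf' (Suc i) v)"
    proof (cases "new v")
      case True
      have "leader \<in> hop_ball E (Suc i) v" using True by (auto simp: new_def)
      then show ?thesis unfolding out using True newL[OF True] by (simp add: pf'_def Let_def del: hop_ball.simps)
    next
      case False
      then have "(leader \<in> hop_ball E (Suc i) v) = (leader \<in> hop_ball E i v)" by (auto simp: new_def)
      then show ?thesis unfolding out using False by (simp add: pf'_def del: hop_ball.simps)
    qed
  qed
  moreover have "pf' leader = leader" using pr by (simp add: pf'_def new_def)
  moreover have "\<forall>v\<in>V. v \<noteq> leader \<longrightarrow> leader \<in> hop_ball E (Suc i) v \<longrightarrow> E v (pf' v) \<and> level v = Suc (level (pf' v))"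
  proof (intro ballI impI)
    fix v assume v: "v \<in> V" "v \<noteq> leader" "leader \<in> hop_ball E (Suc i) v"
    show "E v (pf' v) \<and> level v = Suc (level (pf' v))"
    proof (cases "new v")
      case True
      then show ?thesis using newL[OF True] level_next[of i v "pf' v"] by (simp add: nbrs_def new_def)
    next
      case False
      then have "leader \<in> hop_ball E i v" using v(3) by (auto simp: new_def)
      then show ?thesis using pf v False by (simp add: pf'_def)
    qed
  qed
  ultimately show ?case by (intro exI[of _ pf']) simp
qed

lemma steps_Spread_all:
  assumes "b \<noteq> 0" "\<And>v. v \<in> V \<Longrightarrow> parent (q v) = v \<and> cast (q v) = (if v = leader then b else 0)"
    and H: "\<And>v. v \<in> V \<Longrightarrow> leader \<in> hop_ball E H v"
  shows "\<exists>pf. steps (Suc H) (c\<lparr>stage := Spread H\<rparr>) q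
      (c\<lparr>stage := (if todo c \<le> 1 then Join else Load), prefix := 2 * prefix c + (b - 1), todo := todo c - 1\<rparr>)
      (\<lambda>v. (q v)\<lparr>parent := pf v, cast := b\<rparr>) \<and> bfs_tree H pf"
proof -
  have "\<exists>pf. steps H (c\<lparr>stage := Spread (H + 0)\<rparr>) q (c\<lparr>stage := Spread 0\<rparr>)
      (\<lambda>v. (q v)\<lparr>parent := pf v, cast := (if leader \<in> hop_ball E H v then b else 0)\<rparr>) \<and>
    pf leader = leader \<and>
    (\<forall>v\<in>V. v \<noteq> leader \<longrightarrow> leader \<in> hop_ball E H v \<longrightarrow> E v (pf v) \<and> level v = Suc (level (pf v)))"
    by (rule steps_Spread) (use assms in auto)
  then obtain pf where pf: "steps H (c\<lparr>stage := Spread H\<rparr>) q (c\<lparr>stage := Spread 0\<rparr>)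
      (\<lambda>v. (q v)\<lparr>parent := pf v, cast := (if leader \<in> hop_ball E H v then b else 0)\<rparr>)"
     "pf leader = leader" "\<forall>v\<in>V. v \<noteq> leader \<longrightarrow> leader \<in> hop_ball E H v \<longrightarrow> E v (pf v) \<and> level v = Suc (level (pf v))"
    by auto
  have "steps (Suc H) (c\<lparr>stage := Spread H\<rparr>) q
      (c\<lparr>stage := (if todo c \<le> 1 then Join else Load), prefix := 2 * prefix c + (b - 1), todo := todo c - 1\<rparr>)
      (\<lambda>v. (q v)\<lparr>parent := pf v, cast := b\<rparr>)"
    using pf(1) by (rule steps_Suc) (use H in \<open>simp add: node_step.simps\<close>)
  moreover have "bfs_tree H pf" unfolding bfs_tree_def using pf(2,3) H level_le by blast
  ultimately show ?thesis by blast
qed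

section \<open>Summation towards the root\<close>

fun subtotal :: "(nat \<Rightarrow> nat) \<Rightarrow> (nat \<Rightarrow> nat) \<Rightarrow> nat \<Rightarrow> nat \<Rightarrow> nat" where
  "subtotal pf x 0 v = x v"
| "subtotal pf x (Suc k) v = x v + (\<Sum>u\<in>{u \<in> nbrs E v. pf u = v}. subtotal pf x k u)"

text \<open>The children of the vertices on level \<open>l\<close> partition level
  \<open>l + 1\<close>, so summing over whole levels unfolds the recursion one level at a
  time.\<close>

lemma subtotal_level:
  assumes T: "bfs_tree H pf"
  shows "(\<Sum>v\<in>{v \<in> V. level v = l}. subtotal pf x k v) = (\<Sum>v\<in>{v \<in> V. l \<le> level v \<and> level v \<le> l + k}. x v)"
proof (induction k arbitrary: l)
  case 0
  have "{v \<in> V. level v = l} = {v \<in> V. l \<le> level v \<and> level v \<le> l + 0}" by auto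
  then show ?case by simp
next
  case (Suc k)
  let ?S = "{u \<in> V. level u = Suc l}" and ?T = "{v \<in> V. level v = l}"
  \<comment> \<open>The leader is its own parent but not its own neighbour, so it is nobody's
    child.\<close>
  have ch: "{u \<in> nbrs E v. pf u = v} = {u \<in> ?S. pf u = v}" if v: "v \<in> ?T" for v
  proof (intro set_eqI iffI)
    fix u assume u: "u \<in> {u \<in> nbrs E v. pf u = v}"
    then have "u \<in> V" "E v u" using nbrs_V by (auto simp: nbrs_def)
    moreover have "u \<noteq> leader" using T u E_irrefl by (auto simp: bfs_tree_def nbrs_def)
    ultimately show "u \<in> {u \<in> ?S. pf u = v}" using T u v by (auto simp: bfs_tree_def)
  next
    fix u assume u: "u \<in> {u \<in> ?S. pf u = v}"
    then have "u \<noteq> leader" by auto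
    then show "u \<in> {u \<in> nbrs E v. pf u = v}" using T u E_sym by (auto simp: bfs_tree_def nbrs_def)
  qed
  have img: "pf ` ?S \<subseteq> ?T"
  proof
    fix y assume "y \<in> pf ` ?S"
    then obtain u where u: "u \<in> V" "level u = Suc l" "y = pf u" by auto
    then have "u \<noteq> leader" by auto
    then have "E u y" "level u = Suc (level y)" using T u by (auto simp: bfs_tree_def)
    then show "y \<in> ?T" using u E_V by auto
  qed
  have "(\<Sum>v\<in>?T. subtotal pf x (Suc k) v) = (\<Sum>v\<in>?T. x v) + (\<Sum>v\<in>?T. \<Sum>u\<in>{u \<in> ?S. pf u = v}. subtotal pf x k u)"
    unfolding sum.distrib[symmetric] using ch by (intro sum.cong refl) simp
  also have "(\<Sum>v\<in>?T. \<Sum>u\<in>{u \<in> ?S. pf u = v}. subtotal pf x k u) = (\<Sum>u\<in>?S. subtotal pf x k u)"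
    using finite_V img by (intro sum.group) auto
  also have "\<dots> = (\<Sum>v\<in>{v \<in> V. Suc l \<le> level v \<and> level v \<le> Suc l + k}. x v)" by (rule Suc.IH)
  also have "(\<Sum>v\<in>?T. x v) + \<dots> = (\<Sum>v\<in>?T \<union> {v \<in> V. Suc l \<le> level v \<and> level v \<le> Suc l + k}. x v)"
    using finite_V by (intro sum.union_disjoint[symmetric]) auto
  also have "?T \<union> {v \<in> V. Suc l \<le> level v \<and> level v \<le> Suc l + k} = {v \<in> V. l \<le> level v \<and> level v \<le> l + Suc k}"
    by auto
  finally show ?case .
qed

lemma subtotal_leader:
  assumes T: "bfs_tree H pf" and H: "\<And>v. v \<in> V \<Longrightarrow> leader \<in> hop_ball E H v"
  shows "subtotal pf x H leader = (\<Sum>v\<in>V. x v)"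
proof -
  have "v = leader" if "v \<in> V" "level v = 0" for v
    using leader_in_level[OF H[OF that(1)]] that(2) by simp
  then have "{v \<in> V. level v = 0} \<subseteq> {leader}" by blast
  then have "{v \<in> V. level v = 0} = {leader}" using leader_V level_leader by blast
  moreover have "{v \<in> V. 0 \<le> level v \<and> level v \<le> 0 + H} = V" using T by (auto simp: bfs_tree_def)
  ultimately show ?thesis using subtotal_level[OF T, of x H 0] by simp
qed

text \<open>Partial sums never exceed the total; therefore capping does not alter them when the
  total is below the cap.\<close>

lemma subtotal_le:
  assumes T: "bfs_tree H pf" and v: "v \<in> V"
  shows "subtotal pf x k v \<le> (\<Sum>v\<in>V. x v)"
proof -
  have "subtotal pf x k v \<le> (\<Sum>u\<in>{u \<in> V. level u = level v}. subtotal pf x k u)"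
    using finite_V v by (intro member_le_sum) auto
  also have "\<dots> = (\<Sum>u\<in>{u \<in> V. level v \<le> level u \<and> level u \<le> level v + k}. x u)" by (rule subtotal_level[OF T])
  also have "\<dots> \<le> (\<Sum>u\<in>V. x u)" using finite_V by (intro sum_mono2) auto
  finally show ?thesis .
qed

text \<open>The value of \<open>local_weight\<close> once all vertices know the leader and
  \<open>j\<close> bits remain after the current one.\<close>

definition vote :: "(nat \<Rightarrow> pub) \<Rightarrow> nat \<Rightarrow> nat \<Rightarrow> nat \<Rightarrow> nat \<Rightarrow> nat" where
  "vote q j p p' v = weight leader j v {u \<in> nbrs E v. status (q u) = 0} (\<lambda>u. deg (q u)) (status (q v)) p p'"

text \<open>Every round recomputes a tally from the vertex's own vote and the previous tallies of
  its children. The cap is inactive by \<open>subtotal_le\<close>.\<close>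

lemma steps_Gather:
  assumes lead: "\<And>v. v \<in> V \<Longrightarrow> lead (q v) = leader" and T: "bfs_tree H (\<lambda>v. parent (q v))"
    and c: "prefix c = p" "todo c = Suc j"
    and cap: "(\<Sum>v\<in>V. vote q j (2 * p) (2 * p + 1) v) \<le> cap leader"
      "(\<Sum>v\<in>V. vote q j (2 * p + 1) (2 * p) v) \<le> cap leader"
    and H: "height c = i + k"
  shows "steps (Suc i) (c\<lparr>stage := Load\<rparr>) q (c\<lparr>stage := Gather k\<rparr>)
     (\<lambda>v. (q v)\<lparr>tally0 := subtotal (\<lambda>v. parent (q v)) (vote q j (2 * p) (2 * p + 1)) i v,
               tally1 := subtotal (\<lambda>v. parent (q v)) (vote q j (2 * p + 1) (2 * p)) i v\<rparr>)"
  using H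
proof (induction i arbitrary: k)
  have lw: "local_weight v (nbrs E v) (c\<lparr>stage := s\<rparr>) (\<lambda>u. (q u)\<lparr>tally0 := f u, tally1 := g u\<rparr>) a b = vote q j a b v"
    and lw': "local_weight v (nbrs E v) (c\<lparr>stage := s\<rparr>) q a b = vote q j a b v"
    if "v \<in> V" for v s f g a b
    using lead[OF that] c by (simp_all add: local_weight_def vote_def)
  have min: "min (cap leader) (subtotal (\<lambda>v. parent (q v)) (vote q j (2 * p) (2 * p + 1)) k v)
          = subtotal (\<lambda>v. parent (q v)) (vote q j (2 * p) (2 * p + 1)) k v"
    "min (cap leader) (subtotal (\<lambda>v. parent (q v)) (vote q j (2 * p + 1) (2 * p)) k v)
          = subtotal (\<lambda>v. parent (q v)) (vote q j (2 * p + 1) (2 * p)) k v" if "v \<in> V" for v k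
    using subtotal_le[OF T that] cap by (auto simp: min_def intro: antisym order_trans)
  {
    case 0
    show ?case
    proof (rule steps_1)
      fix v assume v: "v \<in> V"
      show "node_step v (nbrs E v) (c\<lparr>stage := Load\<rparr>) q = (c\<lparr>stage := Gather k\<rparr>,
       (q v)\<lparr>tally0 := subtotal (\<lambda>v. parent (q v)) (vote q j (2 * p) (2 * p + 1)) 0 v,
               tally1 := subtotal (\<lambda>v. parent (q v)) (vote q j (2 * p + 1) (2 * p)) 0 v\<rparr>)"
        using 0 min[OF v, of 0] c lead[OF v] by (simp add: node_step.simps lw'[OF v])
    qed
  next
    case (Suc i)
    have "steps (Suc i) (c\<lparr>stage := Load\<rparr>) q (c\<lparr>stage := Gather (Suc k)\<rparr>)
     (\<lambda>v. (q v)\<lparr>tally0 := subtotal (\<lambda>v. parent (q v)) (vote q j (2 * p) (2 * p + 1)) i v,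
               tally1 := subtotal (\<lambda>v. parent (q v)) (vote q j (2 * p + 1) (2 * p)) i v\<rparr>)"
      using Suc.prems by (intro Suc.IH) simp
    then show ?case
    proof (rule steps_Suc)
      fix v assume v: "v \<in> V"
      show "node_step v (nbrs E v) (c\<lparr>stage := Gather (Suc k)\<rparr>)
        (\<lambda>v. (q v)\<lparr>tally0 := subtotal (\<lambda>v. parent (q v)) (vote q j (2 * p) (2 * p + 1)) i v,
               tally1 := subtotal (\<lambda>v. parent (q v)) (vote q j (2 * p + 1) (2 * p)) i v\<rparr>)
       = (c\<lparr>stage := Gather k\<rparr>,
       (q v)\<lparr>tally0 := subtotal (\<lambda>v. parent (q v)) (vote q j (2 * p) (2 * p + 1)) (Suc i) v,
               tally1 := subtotal (\<lambda>v. parent (q v)) (vote q j (2 * p + 1) (2 * p)) (Suc i) v\<rparr>)"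
        using min[OF v, of "Suc i"] c lead[OF v] by (simp add: node_step.simps lw[OF v])
    qed
  }
qed

text \<open>Fixing a seed bit leaves these fields alone, and they include all that
  \<open>vote\<close> reads.\<close>

definition same :: "(nat \<Rightarrow> pub) \<Rightarrow> (nat \<Rightarrow> pub) \<Rightarrow> bool" where
  "same q q' \<longleftrightarrow> (\<forall>v\<in>V. lead (q' v) = lead (q v) \<and> status (q' v) = status (q v) \<and> deg (q' v) = deg (q v))"

lemma vote_same: "same q q' \<Longrightarrow> v \<in> V \<Longrightarrow> vote q' j p p' v = vote q j p p' v"
proof -
  assume s: "same q q'" and v: "v \<in> V"
  have 1: "{u \<in> nbrs E v. status (q' u) = 0} = {u \<in> nbrs E v. status (q u) = 0}"
    using s subsetD[OF nbrs_V] by (auto simp: same_def)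
  have "deg (q' u) = deg (q u)" if "u \<in> insert v {u \<in> nbrs E v. status (q u) = 0}" for u
    using that s v subsetD[OF nbrs_V] by (auto simp: same_def)
  then show ?thesis unfolding vote_def weight_def 1
    using s v gain_cong[of v "{u \<in> nbrs E v. status (q u) = 0}" "\<lambda>u. deg (q' u)" "\<lambda>u. deg (q u)"]
      loss_cong[of v "{u \<in> nbrs E v. status (q u) = 0}" "\<lambda>u. deg (q' u)" "\<lambda>u. deg (q u)"]
    by (simp add: same_def)
qed

definition ready :: "nat \<Rightarrow> (nat \<Rightarrow> pub) \<Rightarrow> bool" where
  "ready H q \<longleftrightarrow> (\<forall>v\<in>V. lead (q v) = leader \<and> leader \<in> hop_ball E H v) \<and> bfs_tree H (\<lambda>v. parent (q v))"

text \<open>The rounds are \<open>H + 1\<close> for loading and gathering, one for the leader's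
  decision and \<open>H + 1\<close> for the broadcast. The broadcast builds a tree anew, which
  restores \<open>ready\<close> for the next bit.\<close>

lemma steps_bit:
  assumes R: "ready H q"
    and cap: "(\<Sum>v\<in>V. vote q j (2 * p) (2 * p + 1) v) \<le> cap leader"
      "(\<Sum>v\<in>V. vote q j (2 * p + 1) (2 * p) v) \<le> cap leader"
  defines "b \<equiv> (if (\<Sum>v\<in>V. vote q j (2 * p + 1) (2 * p) v) \<le> (\<Sum>v\<in>V. vote q j (2 * p) (2 * p + 1) v) then 0 else 1)"
  shows "\<exists>q'. steps (2 * H + 3) \<lparr>stage = Load, height = H, prefix = p, todo = Suc j\<rparr> q
     \<lparr>stage = (if j = 0 then Join else Load), height = H, prefix = 2 * p + b, todo = j\<rparr> q' \<and> ready H q' \<and> same q q'"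
proof -
  let ?c = "\<lparr>stage = Load, height = H, prefix = p, todo = Suc j\<rparr>"
  let ?s0 = "subtotal (\<lambda>v. parent (q v)) (vote q j (2 * p) (2 * p + 1)) H"
  let ?s1 = "subtotal (\<lambda>v. parent (q v)) (vote q j (2 * p + 1) (2 * p)) H"
  define q1 where "q1 = (\<lambda>v. (q v)\<lparr>tally0 := ?s0 v, tally1 := ?s1 v\<rparr>)"
  define q2 where "q2 = (\<lambda>v. (q1 v)\<lparr>parent := v, cast := (if v = leader then b + 1 else 0)\<rparr>)"
  have T: "bfs_tree H (\<lambda>v. parent (q v))" and lead: "\<And>v. v \<in> V \<Longrightarrow> lead (q v) = leader"
    and HB: "\<And>v. v \<in> V \<Longrightarrow> leader \<in> hop_ball E H v" using R by (auto simp: ready_def)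
  have "steps (Suc H) (?c\<lparr>stage := Load\<rparr>) q (?c\<lparr>stage := Gather 0\<rparr>) q1"
    unfolding q1_def by (rule steps_Gather[where H = H]) (use lead T cap in auto)
  moreover have "?c\<lparr>stage := Load\<rparr> = ?c" by simp
  ultimately have "steps (Suc H) ?c q (?c\<lparr>stage := Gather 0\<rparr>) q1" by (simp only:)
  then have s2: "steps (Suc (Suc H)) ?c q (?c\<lparr>stage := Spread H\<rparr>) q2"
  proof (rule steps_Suc)
    fix v assume v: "v \<in> V"
    have "?s0 leader = (\<Sum>v\<in>V. vote q j (2 * p) (2 * p + 1) v)" "?s1 leader = (\<Sum>v\<in>V. vote q j (2 * p + 1) (2 * p) v)"
      by (rule subtotal_leader[OF T HB]; assumption)+
    then show "node_step v (nbrs E v) (?c\<lparr>stage := Gather 0\<rparr>) q1 = (?c\<lparr>stage := Spread H\<rparr>, q2 v)"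
      using lead[OF v] by (simp add: node_step.simps q1_def q2_def b_def)
  qed
  have "\<exists>pf. steps (Suc H) (?c\<lparr>stage := Spread H\<rparr>) q2
      (?c\<lparr>stage := (if todo ?c \<le> 1 then Join else Load), prefix := 2 * prefix ?c + ((b + 1) - 1), todo := todo ?c - 1\<rparr>)
      (\<lambda>v. (q2 v)\<lparr>parent := pf v, cast := b + 1\<rparr>) \<and> bfs_tree H pf"
    by (rule steps_Spread_all) (use HB in \<open>auto simp: q2_def\<close>)
  then obtain pf where pf: "bfs_tree H pf" and s3: "steps (Suc H) (?c\<lparr>stage := Spread H\<rparr>) q2
     \<lparr>stage = (if j = 0 then Join else Load), height = H, prefix = 2 * p + b, todo = j\<rparr> (\<lambda>v. (q2 v)\<lparr>parent := pf v, cast := b + 1\<rparr>)"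
    by auto
  have "Suc (Suc H) + Suc H = 2 * H + 3" by simp
  then have "steps (2 * H + 3) ?c q \<lparr>stage = (if j = 0 then Join else Load), height = H, prefix = 2 * p + b, todo = j\<rparr>
      (\<lambda>v. (q2 v)\<lparr>parent := pf v, cast := b + 1\<rparr>)" using steps_trans[OF s2 s3] by (simp only:)
  moreover have "ready H (\<lambda>v. (q2 v)\<lparr>parent := pf v, cast := b + 1\<rparr>)"
    using pf lead HB by (simp add: ready_def q2_def q1_def)
  moreover have "same q (\<lambda>v. (q2 v)\<lparr>parent := pf v, cast := b + 1\<rparr>)" by (simp add: same_def q2_def q1_def)
  ultimately show ?thesis by blast
qed

subsection \<open>Conditional expectations and termination\<close>

definition active :: "(nat \<Rightarrow> pub) \<Rightarrow> nat set" where
  "active q = {v \<in> V. status (q v) = 0}"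

definition active_nbrs :: "(nat \<Rightarrow> pub) \<Rightarrow> nat \<Rightarrow> nat set" where
  "active_nbrs q v = {u \<in> nbrs E v. status (q u) = 0}"

text \<open>Every edge between undecided vertices is counted twice, once from each end.\<close>

definition edges :: "(nat \<Rightarrow> pub) \<Rightarrow> nat" where
  "edges q = (\<Sum>v\<in>active q. card {u \<in> active q. E v u})"

definition total_gain :: "(nat \<Rightarrow> pub) \<Rightarrow> nat \<Rightarrow> nat" where
  "total_gain q s = (\<Sum>v\<in>active q. gain (modulus leader) (active_nbrs q v) (\<lambda>u. deg (q u)) v s)"

definition total_loss :: "(nat \<Rightarrow> pub) \<Rightarrow> nat \<Rightarrow> nat" where
  "total_loss q s = (\<Sum>v\<in>active q. loss (modulus leader) (active_nbrs q v) (\<lambda>u. deg (q u)) v s)"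

lemma finite_active: "finite (active q)" using finite_V by (simp add: active_def)

lemma active_nbrs_eq: "active_nbrs q v = {u \<in> active q. E v u}"
  using E_V by (auto simp: active_nbrs_def active_def nbrs_def)

lemma sum_vote:
  "(\<Sum>v\<in>V. vote q j p p' v) = (\<Sum>s\<in>block j p. total_gain q s) + (\<Sum>s\<in>block j p'. total_loss q s)"
proof -
  let ?g = "\<lambda>v s. gain (modulus leader) (active_nbrs q v) (\<lambda>u. deg (q u)) v s"
  let ?l = "\<lambda>v s. loss (modulus leader) (active_nbrs q v) (\<lambda>u. deg (q u)) v s"
  have "(\<Sum>v\<in>V. vote q j p p' v) = (\<Sum>v\<in>active q. (\<Sum>s\<in>block j p. ?g v s) + (\<Sum>s\<in>block j p'. ?l v s))"
    unfolding active_def vote_def weight_def active_nbrs_def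
    by (rule sum.inter_filter[OF finite_V, symmetric])
  also have "\<dots> = (\<Sum>s\<in>block j p. total_gain q s) + (\<Sum>s\<in>block j p'. total_loss q s)"
    unfolding sum.distrib total_gain_def total_loss_def by (intro arg_cong2[where f = "(+)"] sum.swap)
  finally show ?thesis .
qed

text \<open>With \<open>n\<close> vertices a seed contributes at most \<open>n ^ 3\<close> to the
  gain and \<open>2 * n ^ 4\<close> to the loss, and there are \<open>2 ^ j\<close> seeds in each
  block.\<close>

lemma vote_cap:
  assumes deg: "\<And>v. v \<in> V \<Longrightarrow> deg (q v) \<le> card V" and j: "j \<le> seed_bits leader"
  shows "(\<Sum>v\<in>V. vote q j p p' v) \<le> cap leader"
proof -
  let ?n = "card V" and ?b = "2 ^ id_bits leader :: nat"
  have nb: "?n \<le> ?b" by (rule card_le_id_bits[OF finite_V])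
  have sub: "active_nbrs q v \<subseteq> V" for v using nbrs_V by (auto simp: active_nbrs_def)
  have fin: "finite (active_nbrs q v)" "card (active_nbrs q v) \<le> ?n" for v
    using sub finite_V finite_subset card_mono by metis+
  have act: "card (active q) \<le> ?n" using finite_V by (auto simp: active_def intro: card_mono)
  have d: "deg (q u) \<le> ?n" if "v \<in> active q" "u \<in> insert v (active_nbrs q v)" for u v
    using that deg sub[of v] by (auto simp: active_def)
  have "total_gain q s \<le> (\<Sum>v\<in>active q. ?n * ?n)" for s
    unfolding total_gain_def using fin d by (intro sum_mono gain_le) auto
  moreover have "(\<Sum>v\<in>active q. ?n * ?n) \<le> ?n * (?n * ?n)" using act by (simp add: mult_right_mono)
  ultimately have g: "total_gain q s \<le> ?n * (?n * ?n)" for s using order_trans by blast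
  have "total_loss q s \<le> (\<Sum>v\<in>active q. 2 * (?n * ?n * ?n))" for s
    unfolding total_loss_def using fin d by (intro sum_mono loss_le) auto
  moreover have "(\<Sum>v\<in>active q. 2 * (?n * ?n * ?n)) \<le> ?n * (2 * (?n * ?n * ?n))" using act by (simp add: mult_right_mono)
  ultimately have l: "total_loss q s \<le> ?n * (2 * (?n * ?n * ?n))" for s using order_trans by blast
  have n4: "?n * (?n * ?n) \<le> ?b ^ 4" "?n * (2 * (?n * ?n * ?n)) \<le> 2 * ?b ^ 4"
  proof -
    have "?n ^ 3 \<le> ?b ^ 3" "?n ^ 4 \<le> ?b ^ 4" using nb by (simp_all add: power_mono)
    moreover have "?b ^ 3 \<le> ?b ^ 4" by (intro power_increasing) auto
    moreover have "?n * (?n * ?n) = ?n ^ 3" "?n * (2 * (?n * ?n * ?n)) = 2 * ?n ^ 4"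
      by (simp_all add: power3_eq_cube power4_eq_xxxx)
    ultimately show "?n * (?n * ?n) \<le> ?b ^ 4" "?n * (2 * (?n * ?n * ?n)) \<le> 2 * ?b ^ 4" by linarith+
  qed
  have "(\<Sum>v\<in>V. vote q j p p' v) \<le> (\<Sum>s\<in>block j p. ?b ^ 4) + (\<Sum>s\<in>block j p'. 2 * ?b ^ 4)"
    unfolding sum_vote using g l n4 by (intro add_mono sum_mono) (meson order_trans)+
  also have "\<dots> = 2 ^ j * (3 * ?b ^ 4)" by (simp add: card_block)
  also have "\<dots> \<le> 2 ^ seed_bits leader * (2 ^ 2 * ?b ^ 4)" using j by (intro mult_mono power_increasing) auto
  also have "\<dots> = 2 ^ (seed_bits leader + 2 + id_bits leader * 4)" by (simp only: power_add power_mult mult.assoc)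
  also have "\<dots> \<le> cap leader" unfolding cap_def seed_bits_def by (intro power_increasing) auto
  finally show ?thesis .
qed

lemma same_trans: "same q q' \<Longrightarrow> same q' q'' \<Longrightarrow> same q q''"
  by (simp add: same_def)

text \<open>The method of conditional expectations: the better half of a block carries at least half
  of its sum of gain minus loss. Iterating down to a single seed yields one that is at least as good
  as the average over the block. The record \<open>q0\<close> keeps the data of the estimator fixed
  while \<open>q\<close> evolves.\<close>

lemma seed_search:
  assumes "ready H q" "same q0 q" "\<And>v. v \<in> V \<Longrightarrow> deg (q0 v) \<le> card V" "Suc j \<le> seed_bits leader"
  shows "\<exists>s q'. steps (Suc j * (2 * H + 3)) \<lparr>stage = Load, height = H, prefix = p, todo = Suc j\<rparr> q
       \<lparr>stage = Join, height = H, prefix = s, todo = 0\<rparr> q' \<and> ready H q' \<and> same q0 q' \<and>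
     (\<Sum>s\<in>block (Suc j) p. int (total_gain q0 s) - int (total_loss q0 s))
       \<le> 2 ^ Suc j * (int (total_gain q0 s) - int (total_loss q0 s))"
  using assms
proof (induction j arbitrary: p q)
  case (0 p q)
  let ?f = "\<lambda>s. int (total_gain q0 s) - int (total_loss q0 s)"
  have v: "(\<Sum>v\<in>V. vote q 0 a b v) = (\<Sum>v\<in>V. vote q0 0 a b v)" for a b
    using vote_same[OF 0(2)] by simp
  have v': "(\<Sum>v\<in>V. vote q 0 a b v) = (\<Sum>s\<in>block 0 a. total_gain q0 s) + (\<Sum>s\<in>block 0 b. total_loss q0 s)" for a b
    unfolding v by (rule sum_vote)
  have cap: "(\<Sum>v\<in>V. vote q 0 a b v) \<le> cap leader" for a b
    unfolding v by (rule vote_cap) (use 0 in auto)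
  define b :: nat where "b = (if (\<Sum>v\<in>V. vote q 0 (2 * p + 1) (2 * p) v) \<le> (\<Sum>v\<in>V. vote q 0 (2 * p) (2 * p + 1) v) then 0 else 1)"
  obtain q' where q': "steps (2 * H + 3) \<lparr>stage = Load, height = H, prefix = p, todo = Suc 0\<rparr> q
     \<lparr>stage = Join, height = H, prefix = 2 * p + b, todo = 0\<rparr> q'" "ready H q'" "same q q'"
    using steps_bit[OF 0(1) cap cap] unfolding b_def by auto
  have "(\<Sum>s\<in>block (Suc 0) p. ?f s) \<le> 2 * ?f (2 * p + b)"
    unfolding sum_block_Suc b_def v' block_0 by auto
  then show ?case using q' same_trans[OF 0(2) q'(3)]
    by (intro exI[of _ "2 * p + b"] exI[of _ q']) simp
next
  case (Suc j p q)
  let ?f = "\<lambda>s. int (total_gain q0 s) - int (total_loss q0 s)"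
  have v: "(\<Sum>v\<in>V. vote q (Suc j) a b v) = (\<Sum>v\<in>V. vote q0 (Suc j) a b v)" for a b
    using vote_same[OF Suc.prems(2)] by simp
  have v': "(\<Sum>v\<in>V. vote q (Suc j) a b v) = (\<Sum>s\<in>block (Suc j) a. total_gain q0 s) + (\<Sum>s\<in>block (Suc j) b. total_loss q0 s)" for a b
    unfolding v by (rule sum_vote)
  have cap: "(\<Sum>v\<in>V. vote q (Suc j) a b v) \<le> cap leader" for a b
    unfolding v by (rule vote_cap) (use Suc.prems in auto)
  define b :: nat where "b = (if (\<Sum>v\<in>V. vote q (Suc j) (2 * p + 1) (2 * p) v) \<le> (\<Sum>v\<in>V. vote q (Suc j) (2 * p) (2 * p + 1) v) then 0 else 1)"
  obtain q1 where q1: "steps (2 * H + 3) \<lparr>stage = Load, height = H, prefix = p, todo = Suc (Suc j)\<rparr> q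
     \<lparr>stage = Load, height = H, prefix = 2 * p + b, todo = Suc j\<rparr> q1" "ready H q1" "same q q1"
    using steps_bit[OF Suc.prems(1) cap cap] unfolding b_def by auto
  have s1: "same q0 q1" by (rule same_trans[OF Suc.prems(2) q1(3)])
  have "Suc j \<le> seed_bits leader" using Suc.prems(4) by simp
  from Suc.IH[OF q1(2) s1 Suc.prems(3) this, of "2 * p + b"] obtain s q' where
    q': "steps (Suc j * (2 * H + 3)) \<lparr>stage = Load, height = H, prefix = 2 * p + b, todo = Suc j\<rparr> q1
       \<lparr>stage = Join, height = H, prefix = s, todo = 0\<rparr> q'" "ready H q'" "same q0 q'"
     "(\<Sum>s\<in>block (Suc j) (2 * p + b). ?f s) \<le> 2 ^ Suc j * ?f s" by blast
  have "steps (2 * H + 3 + Suc j * (2 * H + 3)) \<lparr>stage = Load, height = H, prefix = p, todo = Suc (Suc j)\<rparr> q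
       \<lparr>stage = Join, height = H, prefix = s, todo = 0\<rparr> q'" by (rule steps_trans[OF q1(1) q'(1)])
  then have st: "steps (Suc (Suc j) * (2 * H + 3)) \<lparr>stage = Load, height = H, prefix = p, todo = Suc (Suc j)\<rparr> q
       \<lparr>stage = Join, height = H, prefix = s, todo = 0\<rparr> q'" by (simp only: mult_Suc)
  \<comment> \<open>After moving the losses across the inequality, the comparison of votes compares
    the two sums of \<open>?f\<close>, so the chosen half is the larger.\<close>
  have choice: "(\<Sum>s\<in>block (Suc j) (2 * p). ?f s) + (\<Sum>s\<in>block (Suc j) (2 * p + 1). ?f s)
      \<le> 2 * (\<Sum>s\<in>block (Suc j) (2 * p + b). ?f s)"
    unfolding b_def v' sum_subtractf by (auto simp flip: of_nat_sum)
  have "(\<Sum>s\<in>block (Suc (Suc j)) p. ?f s) \<le> 2 * (\<Sum>s\<in>block (Suc j) (2 * p + b). ?f s)"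
    using choice by (simp only: sum_block_Suc[of _ "Suc j"])
  also have "\<dots> \<le> 2 ^ Suc (Suc j) * ?f s" using q'(4) by simp
  finally show ?case using st q'(2,3) by blast
qed

section \<open>The invariant of the partial independent set\<close>

definition valid :: "(nat \<Rightarrow> pub) \<Rightarrow> bool" where
  "valid q \<longleftrightarrow> (\<forall>u\<in>V. \<forall>v\<in>V. status (q u) = 1 \<longrightarrow> E u v \<longrightarrow> status (q v) = 2) \<and>
     (\<forall>v\<in>V. status (q v) = 2 \<longrightarrow> (\<exists>u\<in>V. E v u \<and> status (q u) = 1)) \<and>
     (\<forall>v\<in>V. status (q v) \<le> 2)"

lemma valid_cong:
  assumes val: "valid q" and eq: "\<And>v. v \<in> V \<Longrightarrow> status (q' v) = status (q v)"
  shows "valid q'"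
  unfolding valid_def
proof (intro conjI ballI impI)
  fix u v assume uv: "u \<in> V" "v \<in> V" "status (q' u) = 1" "E u v"
  then have "status (q u) = 1" using eq by metis
  then have "status (q v) = 2" using val uv unfolding valid_def by blast
  then show "status (q' v) = 2" using eq uv by metis
next
  fix v assume v: "v \<in> V" "status (q' v) = 2"
  then have "status (q v) = 2" using eq by metis
  then obtain u where "u \<in> V" "E v u" "status (q u) = 1" using val v unfolding valid_def by blast
  then show "\<exists>u\<in>V. E v u \<and> status (q' u) = 1" using eq by metis
next
  fix v assume v: "v \<in> V"
  then have "status (q v) \<le> 2" using val unfolding valid_def by blast
  then show "status (q' v) \<le> 2" using eq v by metis
qed

lemma active_graph_active: "active_graph (active q) E"
  using finite_active E_sym E_irrefl by unfold_locales

text \<open>Two adjacent vertices cannot both be strict minima, and by \<open>valid\<close> an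
  undecided vertex has no neighbour in the set, since all neighbours of members have status 2. So
  independence survives joining, and the round \<open>Leave\<close> excludes the neighbours of the
  new members. Without edges every undecided vertex is vacuously a minimum and joins.\<close>

lemma steps_join:
  assumes R: "ready H q" and val: "valid q"
  shows "\<exists>q'. steps 2 \<lparr>stage = Join, height = H, prefix = s, todo = t\<rparr> q
      \<lparr>stage = Degree, height = H, prefix = s, todo = t\<rparr> q' \<and> ready H q' \<and> valid q' \<and>
      active q' \<subseteq> active q - active_graph.removed (active q) E (affine_hash (modulus leader) s) \<and>
      (edges q = 0 \<longrightarrow> active q' = {})"
proof -
  interpret AG: active_graph "active q" E by (rule active_graph_active)
  define h where "h = affine_hash (modulus leader) s"
  define J where "J v \<longleftrightarrow> status (q v) = 0 \<and> (\<forall>u\<in>{u \<in> nbrs E v. status (q u) = 0}. h v < h u)" for v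
  define q1 where "q1 = (\<lambda>v. if J v then (q v)\<lparr>status := 1\<rparr> else q v)"
  define q2 where "q2 = (\<lambda>v. if status (q1 v) = 0 \<and> (\<exists>u\<in>nbrs E v. status (q1 u) = 1) then (q1 v)\<lparr>status := 2\<rparr> else q1 v)"
  have lead: "\<And>v. v \<in> V \<Longrightarrow> lead (q v) = leader" using R by (simp add: ready_def)
  have "steps (Suc 0) \<lparr>stage = Join, height = H, prefix = s, todo = t\<rparr> q
      \<lparr>stage = Leave, height = H, prefix = s, todo = t\<rparr> q1"
    by (rule steps_1) (simp add: node_step.simps lead q1_def J_def h_def Let_def)
  then have "steps (Suc (Suc 0)) \<lparr>stage = Join, height = H, prefix = s, todo = t\<rparr> q
      \<lparr>stage = Degree, height = H, prefix = s, todo = t\<rparr> q2"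
    by (rule steps_Suc) (simp add: node_step.simps q2_def)
  then have st: "steps 2 \<lparr>stage = Join, height = H, prefix = s, todo = t\<rparr> q
      \<lparr>stage = Degree, height = H, prefix = s, todo = t\<rparr> q2" by (simp add: numeral_2_eq_2)
  have "parent (q2 v) = parent (q v)" "lead (q2 v) = lead (q v)" for v by (auto simp: q2_def q1_def)
  then have "ready H q2" using R by (simp add: ready_def)
  have st1: "status (q1 v) = (if J v then 1 else status (q v))" for v by (simp add: q1_def)
  have st2: "status (q2 v) = (if status (q1 v) = 0 \<and> (\<exists>u\<in>nbrs E v. status (q1 u) = 1) then 2 else status (q1 v))" for v
    by (simp add: q2_def)
  have J0: "J v \<Longrightarrow> status (q v) = 0" for v by (simp add: J_def)
  have nbr: "u \<in> nbrs E v \<longleftrightarrow> E v u" for u v by (simp add: nbrs_def)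
  have val1: "E u v \<Longrightarrow> status (q u) = 1 \<Longrightarrow> status (q v) = 2" for u v using val E_V unfolding valid_def by blast
  have val2: "v \<in> V \<Longrightarrow> status (q v) = 2 \<Longrightarrow> \<exists>u. E v u \<and> status (q u) = 1" for v using val unfolding valid_def by blast
  have val3: "v \<in> V \<Longrightarrow> status (q v) \<le> 2" for v using val by (simp add: valid_def)
  have JJ: "J u \<Longrightarrow> E u v \<Longrightarrow> \<not> J v" for u v
  proof
    assume "J u" "E u v" "J v"
    then have "h u < h v" "h v < h u" using E_sym[of u v] by (auto simp: J_def nbr)
    then show False by simp
  qed
  have s1: "status (q2 v) = 1 \<longleftrightarrow> J v \<or> status (q v) = 1" for v using st1 st2 J0 by (auto split: if_splits)
  have "status (q2 v) = 2" if uv: "E u v" "status (q2 u) = 1" for u v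
  proof (cases "J u")
    case True
    then have J: "status (q1 u) = 1" by (simp add: st1)
    have nz: "status (q v) \<noteq> 1" using val1[of v u] E_sym[OF uv(1)] J0[OF True] by auto
    have "v \<in> V" using uv E_V by blast
    then consider "status (q v) = 0" | "status (q v) = 2" using val3[of v] nz by linarith
    then show ?thesis
    proof cases
      case 1
      then have "status (q1 v) = 0" using JJ[OF True uv(1)] by (simp add: st1)
      moreover have "\<exists>w\<in>nbrs E v. status (q1 w) = 1" using J E_sym[OF uv(1)] nbr by blast
      ultimately show ?thesis by (simp add: st2)
    next
      case 2
      then show ?thesis using J0[of v] by (auto simp: st2 st1)
    qed
  next
    case False
    then have "status (q v) = 2" using uv s1 val1 by blast
    then show ?thesis using J0[of v] by (auto simp: st2 st1)
  qed
  moreover have "\<exists>u\<in>V. E v u \<and> status (q2 u) = 1" if v: "v \<in> V" "status (q2 v) = 2" for v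
  proof (cases "status (q v) = 2")
    case True
    then show ?thesis using val2[OF v(1)] s1 E_V by blast
  next
    case False
    then obtain u where u: "E v u" "status (q1 u) = 1" using v st1[of v] by (auto simp: st2 nbr split: if_splits)
    then have "status (q2 u) = 1" by (simp add: st2)
    then show ?thesis using u(1) E_V by blast
  qed
  moreover have "status (q2 v) \<le> 2" if "v \<in> V" for v using val3[OF that] by (simp add: st2 st1)
  ultimately have "valid q2" by (simp add: valid_def)
  have a2: "status (q v) = 0 \<and> \<not> J v \<and> \<not> (\<exists>u. E v u \<and> J u)" if "status (q2 v) = 0" for v
    using that by (auto simp: st2 st1 nbr split: if_splits)
  have Jrem: "J u \<longleftrightarrow> (\<forall>w\<in>AG.N u. h u < h w)" if "u \<in> active q" for u
    using that unfolding J_def AG.N_def active_nbrs_eq[symmetric] active_nbrs_def by (simp add: active_def)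
  have sub: "active q2 \<subseteq> active q - AG.removed h"
  proof
    fix v assume v: "v \<in> active q2"
    have "v \<notin> AG.removed h"
    proof
      assume "v \<in> AG.removed h"
      then obtain u where "u \<in> AG.N v" "\<forall>w\<in>AG.N u. h u < h w" unfolding AG.removed_def by blast
      then have "E v u" "J u" using Jrem[of u] by (auto simp: AG.N_def)
      then show False using a2[of v] v by (auto simp: active_def)
    qed
    then show "v \<in> active q - AG.removed h" using v a2[of v] by (auto simp: active_def)
  qed
  have emp: "active q2 = {}" if e: "edges q = 0"
  proof -
    have "J v" if v: "v \<in> active q" for v
    proof -
      have "card {u \<in> active q. E v u} = 0" using e v finite_active by (simp add: edges_def)
      then have "{u \<in> active q. E v u} = {}" using finite_active by (simp add: card_eq_0_iff)
      then show ?thesis using Jrem[OF v] by (auto simp: AG.N_def)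
    qed
    then show ?thesis using a2 by (auto simp: active_def)
  qed
  show ?thesis
    by (intro exI[of _ q2] conjI impI st \<open>ready H q2\<close> \<open>valid q2\<close> sub[unfolded h_def] emp)
qed

text \<open>One round computes degrees, each seed bit takes \<open>2 * H + 3\<close> rounds, and two
  rounds serve joining and leaving. The seed found is at least average, so it removes at least 1/108
  of the edges.\<close>

lemma steps_phase:
  assumes R: "ready H q" and val: "valid q"
  shows "\<exists>s q'. steps (seed_bits leader * (2 * H + 3) + 3) \<lparr>stage = Degree, height = H, prefix = p, todo = 0\<rparr> q
      \<lparr>stage = Degree, height = H, prefix = s, todo = 0\<rparr> q' \<and> ready H q' \<and> valid q' \<and>
      108 * edges q' \<le> 107 * edges q \<and> (edges q = 0 \<longrightarrow> active q' = {})"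
proof -
  interpret AG: active_graph "active q" E by (rule active_graph_active)
  let ?M = "modulus leader"
  define q0 where "q0 = (\<lambda>v. (q v)\<lparr>deg := card (active_nbrs q v)\<rparr>)"
  obtain j where j: "seed_bits leader = Suc j" by (metis id_bits_def seed_bits_def add.commute mult_2 numeral_eq_Suc add_Suc)
  have lead: "\<And>v. v \<in> V \<Longrightarrow> lead (q v) = leader" using R by (simp add: ready_def)
  have s1: "steps (Suc 0) \<lparr>stage = Degree, height = H, prefix = p, todo = 0\<rparr> q
     \<lparr>stage = Load, height = H, prefix = 0, todo = Suc j\<rparr> q0"
    by (rule steps_1) (simp add: node_step.simps lead q0_def active_nbrs_def j)
  have R0: "ready H q0" using R by (simp add: ready_def q0_def)
  have "active_nbrs q v \<subseteq> V" for v using nbrs_V by (auto simp: active_nbrs_def)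
  then have dq0: "deg (q0 v) \<le> card V" for v unfolding q0_def using finite_V by (auto intro: card_mono)
  have a0: "active q0 = active q" by (auto simp: q0_def active_def)
  have n0: "active_nbrs q0 v = AG.N v" for v by (simp add: active_nbrs_eq AG.N_def a0)
  have d0: "deg (q0 v) = AG.d v" for v by (simp add: q0_def AG.d_def AG.N_def active_nbrs_eq)
  have "same q0 q0" by (simp add: same_def)
  from seed_search[OF R0 this dq0, of j 0] j obtain s q1 where
    q1: "steps (Suc j * (2 * H + 3)) \<lparr>stage = Load, height = H, prefix = 0, todo = Suc j\<rparr> q0
       \<lparr>stage = Join, height = H, prefix = s, todo = 0\<rparr> q1" "ready H q1" "same q0 q1"
     and opt: "(\<Sum>s\<in>block (Suc j) 0. int (total_gain q0 s) - int (total_loss q0 s))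
       \<le> 2 ^ Suc j * (int (total_gain q0 s) - int (total_loss q0 s))" by auto
  have stq1: "v \<in> V \<Longrightarrow> status (q1 v) = status (q v)" for v using q1(3) by (simp add: same_def q0_def)
  have val1: "valid q1" using val stq1 by (rule valid_cong)
  have a1: "active q1 = active q" using stq1 by (auto simp: active_def)
  have e1: "edges q1 = edges q" by (simp add: edges_def a1)
  obtain q2 where q2: "steps 2 \<lparr>stage = Join, height = H, prefix = s, todo = 0\<rparr> q1
      \<lparr>stage = Degree, height = H, prefix = s, todo = 0\<rparr> q2" "ready H q2" "valid q2"
      "active q2 \<subseteq> active q - AG.removed (affine_hash ?M s)" "edges q = 0 \<longrightarrow> active q2 = {}"
    using steps_join[OF q1(2) val1, of s 0] unfolding a1 e1 by (elim exE conjE) (rule that; assumption)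
  have "Suc 0 + Suc j * (2 * H + 3) + 2 = seed_bits leader * (2 * H + 3) + 3" by (simp add: j)
  then have st: "steps (seed_bits leader * (2 * H + 3) + 3) \<lparr>stage = Degree, height = H, prefix = p, todo = 0\<rparr> q
      \<lparr>stage = Degree, height = H, prefix = s, todo = 0\<rparr> q2"
    using steps_trans[OF steps_trans[OF s1 q1(1)] q2(1)] by (simp only:)
  have eq: "edges q = (\<Sum>v\<in>active q. AG.d v)" by (simp add: edges_def AG.d_def AG.N_def)
  have tg: "total_gain q0 s = (\<Sum>v\<in>active q. gain ?M (AG.N v) AG.d v s)"
    and tl: "total_loss q0 s = (\<Sum>v\<in>active q. loss ?M (AG.N v) AG.d v s)" for s
    by (simp_all add: total_gain_def total_loss_def a0 n0 d0)
  have K: "u < 2 ^ id_bits leader" if "u \<in> active q" for u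
    using that finite_V less_id_bits[of leader] by (auto simp: active_def intro: le_less_trans[OF Max_ge])
  have M9: "9 * AG.d v * 2 ^ id_bits leader \<le> ?M" for v
  proof -
    have "AG.d v \<le> 2 ^ id_bits leader" using dq0[of v] card_le_id_bits[OF finite_V] by (simp add: d0)
    then have "9 * AG.d v * 2 ^ id_bits leader \<le> 16 * 2 ^ id_bits leader * 2 ^ id_bits leader" by (intro mult_mono) auto
    also have "\<dots> = ?M" unfolding modulus_def by (simp only: power_add mult_2) simp
    finally show ?thesis .
  qed
  have MM: "?M * ?M = 2 ^ Suc j"
    unfolding j[symmetric] modulus_def seed_bits_def by (simp only: power_add[symmetric] mult_2)
  \<comment> \<open>The \<open>?M * ?M\<close> seeds are the full block with all
    \<open>seed_bits leader\<close> bits free, so the average bounded here is the one that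
    \<open>opt\<close> compares with.\<close>
  have "edges q * (?M * ?M) + 108 * (\<Sum>s<?M*?M. total_loss q0 s) \<le> 108 * (\<Sum>s<?M*?M. total_gain q0 s)"
    unfolding eq tg tl by (rule AG.expectation[OF M9 K])
  then have "int (edges q * (?M * ?M) + 108 * (\<Sum>s<?M*?M. total_loss q0 s)) \<le> int (108 * (\<Sum>s<?M*?M. total_gain q0 s))"
    by (simp only: of_nat_le_iff)
  then have "int (edges q) * 2 ^ Suc j \<le> 108 * (\<Sum>s<?M*?M. int (total_gain q0 s) - int (total_loss q0 s))"
    unfolding MM sum_subtractf by (simp add: algebra_simps)
  also have "\<dots> \<le> 108 * (2 ^ Suc j * (int (total_gain q0 s) - int (total_loss q0 s)))"
    using opt block_seeds[of leader] unfolding j by simp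
  finally have "2 ^ Suc j * int (edges q) \<le> 2 ^ Suc j * (108 * (int (total_gain q0 s) - int (total_loss q0 s)))"
    by (simp only: mult_ac)
  then have gap: "int (edges q) \<le> 108 * (int (total_gain q0 s) - int (total_loss q0 s))"
    by (rule mult_left_le_imp_le) simp
  define R where "R = (\<Sum>v\<in>AG.removed (affine_hash ?M s). AG.d v)"
  have "total_gain q0 s \<le> R + total_loss q0 s"
    unfolding tg tl R_def by (rule AG.sum_gain_le)
  then have "int (total_gain q0 s) - int (total_loss q0 s) \<le> int R" by linarith
  then have "int (edges q) \<le> int (108 * R)" using gap by simp
  then have "edges q \<le> 108 * R" by (simp only: of_nat_le_iff)
  moreover have "edges q2 + R \<le> edges q"
    unfolding eq edges_def[of q2] R_def by (rule AG.edges_decrease[OF q2(4)])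
  ultimately have "108 * edges q2 \<le> 107 * edges q" by linarith
  then show ?thesis using st q2(2,3,5) by (intro exI[of _ s] exI[of _ q2] conjI)
qed

lemma steps_phases:
  assumes "ready H q" "valid q"
  shows "\<exists>s q'. steps (k * (seed_bits leader * (2 * H + 3) + 3)) \<lparr>stage = Degree, height = H, prefix = p, todo = 0\<rparr> q
      \<lparr>stage = Degree, height = H, prefix = s, todo = 0\<rparr> q' \<and> ready H q' \<and> valid q' \<and>
      108 ^ k * edges q' \<le> 107 ^ k * edges q"
proof (induction k)
  case 0
  have "steps 0 \<lparr>stage = Degree, height = H, prefix = p, todo = 0\<rparr> q \<lparr>stage = Degree, height = H, prefix = p, todo = 0\<rparr> q"
    by (rule steps_0) simp
  then show ?case using assms by auto
next
  case (Suc k)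
  let ?P = "seed_bits leader * (2 * H + 3) + 3"
  obtain s q1 where q1: "steps (k * ?P) \<lparr>stage = Degree, height = H, prefix = p, todo = 0\<rparr> q
      \<lparr>stage = Degree, height = H, prefix = s, todo = 0\<rparr> q1" "ready H q1" "valid q1" "108 ^ k * edges q1 \<le> 107 ^ k * edges q"
    using Suc.IH by blast
  obtain s' q2 where q2: "steps ?P \<lparr>stage = Degree, height = H, prefix = s, todo = 0\<rparr> q1
      \<lparr>stage = Degree, height = H, prefix = s', todo = 0\<rparr> q2" "ready H q2" "valid q2" "108 * edges q2 \<le> 107 * edges q1"
    using steps_phase[OF q1(2,3)] by blast
  have "k * ?P + ?P = Suc k * ?P" by simp
  then have "steps (Suc k * ?P) \<lparr>stage = Degree, height = H, prefix = p, todo = 0\<rparr> q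
      \<lparr>stage = Degree, height = H, prefix = s', todo = 0\<rparr> q2" using steps_trans[OF q1(1) q2(1)] by (simp only:)
  moreover have "108 ^ Suc k * edges q2 \<le> 107 ^ Suc k * edges q"
  proof -
    have "108 ^ Suc k * edges q2 = 108 ^ k * (108 * edges q2)" by simp
    also have "\<dots> \<le> 108 ^ k * (107 * edges q1)" using q2(4) by (rule mult_left_mono) simp
    also have "\<dots> = 107 * (108 ^ k * edges q1)" by simp
    also have "\<dots> \<le> 107 * (107 ^ k * edges q)" using q1(4) by (rule mult_left_mono) simp
    finally show ?thesis by simp
  qed
  ultimately show ?case using q2(2,3) by blast
qed

section \<open>Termination and running time\<close>

lemma edges_lt: "edges q < 2 ^ (2 * (floor_log (card V) + 1))"
proof -
  have c: "card {u \<in> active q. P u} \<le> card V" for P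
    using finite_V by (intro card_mono) (auto simp: active_def)
  have a: "card (active q) \<le> card V" using c[of "\<lambda>_. True"] by simp
  have "edges q \<le> (\<Sum>v\<in>active q. card V)" unfolding edges_def by (intro sum_mono c)
  also have "\<dots> \<le> card V * card V" using a by simp
  also have "\<dots> < 2 ^ (floor_log (card V) + 1) * 2 ^ (floor_log (card V) + 1)"
    using floor_log_exp2_gt[of "card V"] by (intro mult_strict_mono) auto
  also have "\<dots> = 2 ^ (2 * (floor_log (card V) + 1))" by (simp only: power_add[symmetric] mult_2)
  finally show ?thesis .
qed

lemma valid_all_decided:
  assumes "valid q" "active q = {}"
  shows "maximal_independent_set V E {v \<in> V. status (q v) = 1}"
proof -
  have "status (q v) = 2" if v: "v \<in> V" "status (q v) \<noteq> 1" for v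
  proof -
    have "status (q v) \<le> 2" using assms(1) v unfolding valid_def by blast
    moreover have "status (q v) \<noteq> 0" using assms(2) v by (auto simp: active_def)
    ultimately show ?thesis using v(2) by linarith
  qed
  moreover have "\<exists>u\<in>V. E u v \<and> status (q u) = 1" if "v \<in> V" "status (q v) = 2" for v
    using assms(1) that E_sym unfolding valid_def by blast
  moreover have "\<not> E u v" if "u \<in> V" "v \<in> V" "status (q u) = 1" "status (q v) = 1" for u v
  proof
    assume "E u v"
    then have "status (q v) = 2" using assms(1) that unfolding valid_def by blast
    then show False using that by simp
  qed
  ultimately show ?thesis unfolding maximal_independent_set_def by blast
qed

lemma mis_time:
  defines "l \<equiv> floor_log (card V) + 1" and "D \<equiv> diameter V E + 1"
  shows "\<exists>T H. computes_MIS_within mis_send mis_out V E T \<and> H \<le> 2 * D \<and>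
     T \<le> 11 * H + 3 + 217 * l * (seed_bits leader * (2 * H + 3) + 3)"
proof -
  define c0 where "c0 = fst (init_state 0)"
  define q0 where "q0 = (\<lambda>v. snd (init_state v))"
  have c0: "stage c0 = Elect (height c0)" "height c0 = 1" by (simp_all add: c0_def init_state_def)
  have init: "sync init_state c0 q0" by (simp add: sync_def c0_def q0_def init_state_def)
  have "\<exists>k H q'. steps k c0 q0 \<lparr>stage = Spread H, height = H, prefix = 0, todo = 1\<rparr> q' \<and>
     k + 5 * height c0 \<le> 10 * H \<and> H \<le> max (height c0) (2 * diameter V E) \<and> elected H q'"
    by (rule leader_election) (auto simp: c0_def q0_def init_state_def)
  then obtain k1 H q1 where s1: "steps k1 c0 q0 \<lparr>stage = Spread H, height = H, prefix = 0, todo = 1\<rparr> q1"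
    and k1: "k1 \<le> 10 * H" and H: "H \<le> 2 * D" and el: "elected H q1" using c0(2) unfolding D_def by fastforce
  let ?P = "seed_bits leader * (2 * H + 3) + 3"
  let ?c = "\<lparr>stage = Spread H, height = H, prefix = 0, todo = 1\<rparr>"
  have HB: "\<And>v. v \<in> V \<Longrightarrow> leader \<in> hop_ball E H v" using el by (simp add: elected_def)
  have "\<exists>pf. steps (Suc H) (?c\<lparr>stage := Spread H\<rparr>) q1
      (?c\<lparr>stage := (if todo ?c \<le> 1 then Join else Load), prefix := 2 * prefix ?c + (1 - 1), todo := todo ?c - 1\<rparr>)
      (\<lambda>v. (q1 v)\<lparr>parent := pf v, cast := 1\<rparr>) \<and> bfs_tree H pf"
    by (rule steps_Spread_all) (use el in \<open>auto simp: elected_def\<close>)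
  then obtain pf where pf: "bfs_tree H pf" and s2: "steps (Suc H) ?c q1
     \<lparr>stage = Join, height = H, prefix = 0, todo = 0\<rparr> (\<lambda>v. (q1 v)\<lparr>parent := pf v, cast := 1\<rparr>)"
    by auto
  let ?q2 = "\<lambda>v. (q1 v)\<lparr>parent := pf v, cast := 1\<rparr>"
  have "ready H ?q2" using pf el by (simp add: ready_def elected_def)
  moreover have "valid ?q2" using el by (simp add: valid_def elected_def)
  ultimately obtain q3 where s3: "steps 2 \<lparr>stage = Join, height = H, prefix = 0, todo = 0\<rparr> ?q2
      \<lparr>stage = Degree, height = H, prefix = 0, todo = 0\<rparr> q3" and q3: "ready H q3" "valid q3"
    using steps_join by blast
  \<comment> \<open>As \<open>edges q3 < 2 ^ (2 * l)\<close>, it takes \<open>2 * l\<close> halvings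
    of 108 phases each to remove all edges.\<close>
  obtain s4 q4 where s4: "steps (108 * (2 * l) * ?P) \<lparr>stage = Degree, height = H, prefix = 0, todo = 0\<rparr> q3
      \<lparr>stage = Degree, height = H, prefix = s4, todo = 0\<rparr> q4" and q4: "ready H q4" "valid q4"
      "108 ^ (108 * (2 * l)) * edges q4 \<le> 107 ^ (108 * (2 * l)) * edges q3"
    using steps_phases[OF q3] by blast
  have "edges q4 = 0" by (rule edges_vanish[OF q4(3)]) (unfold l_def, rule edges_lt)
  \<comment> \<open>One further phase lets the remaining isolated undecided vertices join; this
    turns 216 into 217.\<close>
  then obtain s5 q5 where s5: "steps ?P \<lparr>stage = Degree, height = H, prefix = s4, todo = 0\<rparr> q4
      \<lparr>stage = Degree, height = H, prefix = s5, todo = 0\<rparr> q5" and q5: "valid q5" "active q5 = {}"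
    using steps_phase[OF q4(1,2)] by blast
  define T where "T = k1 + Suc H + 2 + 108 * (2 * l) * ?P + ?P"
  have "steps T c0 q0 \<lparr>stage = Degree, height = H, prefix = s5, todo = 0\<rparr> q5"
    unfolding T_def by (rule steps_trans[OF steps_trans[OF steps_trans[OF steps_trans[OF s1 s2] s3] s4] s5])
  then have "sync ((net_step E ^^ T) init_state) \<lparr>stage = Degree, height = H, prefix = s5, todo = 0\<rparr> q5"
    using init by (simp add: steps_def)
  then have fin: "snd ((net_step E ^^ T) init_state v) = q5 v" if "v \<in> V" for v using that by (simp add: sync_def)
  have set: "{v \<in> V. status (snd ((net_step E ^^ T) init_state v)) = 1} = {v \<in> V. status (q5 v) = 1}"
    using fin by auto
  have "computes_MIS_within mis_send mis_out V E T"
  proof (rule mis_correct_if_decided)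
    show "maximal_independent_set V E {v \<in> V. status (snd ((net_step E ^^ T) init_state v)) = 1}"
      unfolding set by (rule valid_all_decided[OF q5])
    show "\<forall>v\<in>V. status (snd ((net_step E ^^ T) init_state v)) \<noteq> 0" using q5(2) fin by (auto simp: active_def)
  qed
  moreover have "T \<le> 11 * H + 3 + 217 * l * ?P"
  proof -
    have "1 * ?P \<le> l * ?P" by (intro mult_right_mono) (auto simp: l_def)
    then have "108 * (2 * l) * ?P + ?P \<le> 217 * l * ?P" by (simp add: mult.assoc)
    then show ?thesis unfolding T_def using k1 by linarith
  qed
  ultimately show ?thesis using H by blast
qed

end

text \<open>One algorithm serves every \<open>c\<close>; only the constants depend on it. Adding 1
  to diameter and logarithm keeps the bounds positive for a single vertex.\<close>

theorem theorem4:
  shows "\<forall>c::nat. \<exists>(sendf::send_fn) (out::out_fn) (B::nat) (C::nat).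
    \<forall>V E. simple_graph V E \<longrightarrow> connected_graph V E \<longrightarrow>
      (\<forall>v\<in>V. v < 2 ^ (c * (floor_log (card V) + 1))) \<longrightarrow>
      msg_bounded sendf E (B * (floor_log (card V) + 1)) \<and>
      (\<exists>T. T \<le> C * (diameter V E + 1) * (floor_log (card V) + 1)^2 \<and>
           computes_MIS_within sendf out V E T)"
proof
  fix c :: nat
  show "\<exists>(sendf::send_fn) (out::out_fn) (B::nat) (C::nat).
    \<forall>V E. simple_graph V E \<longrightarrow> connected_graph V E \<longrightarrow>
      (\<forall>v\<in>V. v < 2 ^ (c * (floor_log (card V) + 1))) \<longrightarrow>
      msg_bounded sendf E (B * (floor_log (card V) + 1)) \<and>
      (\<exists>T. T \<le> C * (diameter V E + 1) * (floor_log (card V) + 1)^2 \<and>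
           computes_MIS_within sendf out V E T)"
  proof (rule exI[of _ mis_send], rule exI[of _ mis_out], rule exI[of _ "16 * (10 * (c + 1) + 11) + 8"],
      rule exI[of _ "25 + 217 * (28 * c + 87)"], intro allI impI conjI)
    fix V E
    assume G: "simple_graph V E" "connected_graph V E"
      and ids: "\<forall>v\<in>V. v < 2 ^ (c * (floor_log (card V) + 1))"
    show "msg_bounded mis_send E ((16 * (10 * (c + 1) + 11) + 8) * (floor_log (card V) + 1))"
      by (rule mis_msg_bounded[OF G(1) ids])
    interpret network V E using G by unfold_locales
    define l where "l = floor_log (card V) + 1"
    define D where "D = diameter V E + 1"
    obtain T H where mis: "computes_MIS_within mis_send mis_out V E T" and H: "H \<le> 2 * D"
      and T: "T \<le> 11 * H + 3 + 217 * l * (seed_bits leader * (2 * H + 3) + 3)"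
      using mis_time unfolding l_def D_def by blast
    have D1: "1 \<le> D" and l1: "1 \<le> l" by (simp_all add: D_def l_def)
    have "id_bits leader \<le> (c + 1) * l" unfolding l_def using ids leader_V by (intro id_bits_le) blast
    \<comment> \<open>The number of seed bits is \<open>8 + 4 * id_bits leader\<close>, and
      \<open>8 + 4 * (c + 1) = 4 * c + 12\<close>.\<close>
    then have sb: "seed_bits leader \<le> (4 * c + 12) * l" using l1 by (simp add: seed_bits_def algebra_simps)
    have "2 * H + 3 \<le> 7 * D" using H D1 by linarith
    then have "seed_bits leader * (2 * H + 3) \<le> (4 * c + 12) * l * (7 * D)" using sb by (intro mult_mono) auto
    moreover have "1 \<le> l * D" using mult_le_mono[OF l1 D1] by simp
    moreover have "(4 * c + 12) * l * (7 * D) + 3 * (l * D) = (28 * c + 87) * (l * D)" by (simp add: algebra_simps)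
    ultimately have "seed_bits leader * (2 * H + 3) + 3 \<le> (28 * c + 87) * (l * D)" by linarith
    then have "217 * l * (seed_bits leader * (2 * H + 3) + 3) \<le> 217 * l * ((28 * c + 87) * (l * D))"
      by (rule mult_left_mono) simp
    also have "\<dots> = 217 * (28 * c + 87) * (D * l\<^sup>2)" by (simp only: power2_eq_square mult_ac)
    finally have main: "217 * l * (seed_bits leader * (2 * H + 3) + 3) \<le> 217 * (28 * c + 87) * (D * l\<^sup>2)" .
    \<comment> \<open>The 25 arises from \<open>11 * H + 3 \<le> 22 * D + 3 * D\<close>.\<close>
    have "D * 1 \<le> D * l\<^sup>2" using l1 by (intro mult_left_mono) auto
    then have "11 * H + 3 \<le> 25 * (D * l\<^sup>2)" using H D1 by linarith
    then have "T \<le> 25 * (D * l\<^sup>2) + 217 * (28 * c + 87) * (D * l\<^sup>2)" using T main by linarith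
    also have "\<dots> = (25 + 217 * (28 * c + 87)) * D * l\<^sup>2" by (simp add: algebra_simps)
    finally show "\<exists>T. T \<le> (25 + 217 * (28 * c + 87)) * (diameter V E + 1) * (floor_log (card V) + 1)\<^sup>2 \<and>
        computes_MIS_within mis_send mis_out V E T"
      unfolding D_def l_def using mis by blast
  qed
qed

end
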